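(* Let $\Omega\subset\mathbb{R}^n$ be open and $\Gamma$ a closed cone in $\dot T^*\Omega$. The additional seminorms defining the normal topology of $\mathcal{D}'_\Gamma(\Omega)$ can be taken to be countable: there is a countable family of pairs $(\chi_\alpha,V_\alpha)$, with $\chi_\alpha\in\mathcal{D}(\Omega)$ and $V_\alpha\subset\mathbb{R}^n$ a closed cone such that $(\operatorname{supp}\chi_\alpha\times V_\alpha)\cap\Gamma=\emptyset$, such that the normal topology of $\mathcal{D}'_\Gamma(\Omega)$ is defined by the seminorms of the strong topology of $\mathcal{D}'(\Omega)$ together with the countably many seminorms $\|\cdot\|_{N,V_\alpha,\chi_\alpha}$, $N\in\mathbb{N}$.
   Context: Write $\mathcal{D}(\Omega)=C_c^\infty(\Omega)$, $\dot T^*\Omega=\{(x;\xi)\in\Omega\times\mathbb{R}^n : \xi\neq 0\}$. A cone in $\dot T^*\Omega$ is a subset $\Gamma$ such that $(x;\xi)\in\Gamma$ and $\lambda>0$ imply $(x;\lambda\xi)\in\Gamma$; closed means closed in $\dot T^*\Omega$. $\mathcal{D}'_\Gamma(\Omega)=\{u\in\mathcal{D}'(\Omega) : \mathrm{WF}(u)\subset\Gamma\}$. The normal topology on $\mathcal{D}'_\Gamma(\Omega)$ is the locally convex topology defined by the seminorms of the strong topology of $\mathcal{D}'(\Omega)$, namely $p_B(u)=\sup_{\phi\in B}|\langle u,\phi\rangle|$ with $B$ running over the bounded subsets of $\mathcal{D}(\Omega)$, and the additional seminorms $\|u\|_{N,V,\chi}=\sup_{k\in V}(1+|k|)^N|\widehat{u\chi}(k)|$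 for all $N\ge 0$, $\chi\in\mathcal{D}(\Omega)$ and closed cones $V\subset\mathbb{R}^n$ with $(\operatorname{supp}\chi\times V)\cap\Gamma=\emptyset$; here $\widehat{w}(k)=\langle w,e^{-ik\cdot x}\rangle$. *)

theory Defs
  imports "HOL-Analysis.Analysis"
begin

section \<open>Test functions\<close>

definition partial_deriv :: "'n \<Rightarrow> (real^'n \<Rightarrow> complex) \<Rightarrow> real^'n \<Rightarrow> complex" where
  "partial_deriv i f x = frechet_derivative f (at x) (axis i 1)"

text \<open>Iterated partial derivatives are indexed by lists of coordinate directions; on smooth
  functions the order of the list is irrelevant, so a list of length m is a multi-index
  of order m.\<close>

primrec iter_partial :: "'n list \<Rightarrow> (real^'n \<Rightarrow> complex) \<Rightarrow> real^'n \<Rightarrow> complex" where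
  "iter_partial [] f = f"
| "iter_partial (i # ds) f = partial_deriv i (iter_partial ds f)"

text \<open>Differentiability of every iterated partial derivative also gives its continuity, so this
  is the usual class of infinitely often continuously differentiable functions.\<close>

definition smooth :: "(real^'n \<Rightarrow> complex) \<Rightarrow> bool" where
  "smooth f \<longleftrightarrow> (\<forall>ds x. iter_partial ds f differentiable (at x))"

definition supp :: "(real^'n \<Rightarrow> complex) \<Rightarrow> (real^'n) set" where
  "supp f = closure {x. f x \<noteq> 0}"

text \<open>A test function on \<open>\<Omega>\<close> is identified with its extension by zero to the whole space.\<close>

definition test_functions :: "(real^'n) set \<Rightarrow> (real^'n \<Rightarrow> complex) set" where
  "test_functions \<Omega> = {\<phi>. smooth \<phi> \<and> compact (supp \<phi>) \<and> supp \<phi> \<subseteq> \<Omega>}"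

definition Cm_norm :: "nat \<Rightarrow> (real^'n \<Rightarrow> complex) \<Rightarrow> real" where
  "Cm_norm m \<phi> = (\<Sum>ds | length ds \<le> m. SUP x. norm (iter_partial ds \<phi> x))"

text \<open>The continuous seminorms of the canonical inductive limit topology of
  \<open>test_functions \<Omega>\<close>: those whose restriction to the functions supported in any fixed compact
  \<open>K \<subseteq> \<Omega>\<close> is continuous for uniform convergence of all derivatives.\<close>

definition continuous_test_seminorm ::
    "(real^'n) set \<Rightarrow> ((real^'n \<Rightarrow> complex) \<Rightarrow> real) \<Rightarrow> bool" where
  "continuous_test_seminorm \<Omega> p \<longleftrightarrow>
     (\<forall>\<phi>\<in>test_functions \<Omega>. 0 \<le> p \<phi>) \<and>
     (\<forall>\<phi>\<in>test_functions \<Omega>. \<forall>\<psi>\<in>test_functions \<Omega>. p (\<lambda>x. \<phi> x + \<psi> x) \<le> p \<phi> + p \<psi>) \<and>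
     (\<forall>c. \<forall>\<phi>\<in>test_functions \<Omega>. p (\<lambda>x. c * \<phi> x) = norm c * p \<phi>) \<and>
     (\<forall>K. compact K \<and> K \<subseteq> \<Omega> \<longrightarrow>
        (\<exists>C m. \<forall>\<phi>\<in>test_functions \<Omega>. supp \<phi> \<subseteq> K \<longrightarrow> p \<phi> \<le> C * Cm_norm m \<phi>))"

definition bounded_test_set :: "(real^'n) set \<Rightarrow> (real^'n \<Rightarrow> complex) set \<Rightarrow> bool" where
  "bounded_test_set \<Omega> B \<longleftrightarrow>
     B \<subseteq> test_functions \<Omega> \<and> (\<forall>p. continuous_test_seminorm \<Omega> p \<longrightarrow> bdd_above (p ` B))"


section \<open>Distributions and wave front set\<close>

text \<open>Functionals are total functions in HOL; the value 0 outside the test functions makes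
  equality of distributions coincide with equality of functions.\<close>

definition distributions :: "(real^'n) set \<Rightarrow> ((real^'n \<Rightarrow> complex) \<Rightarrow> complex) set" where
  "distributions \<Omega> = {u.
     (\<forall>\<phi>. \<phi> \<notin> test_functions \<Omega> \<longrightarrow> u \<phi> = 0) \<and>
     (\<forall>\<phi>\<in>test_functions \<Omega>. \<forall>\<psi>\<in>test_functions \<Omega>. u (\<lambda>x. \<phi> x + \<psi> x) = u \<phi> + u \<psi>) \<and>
     (\<forall>c. \<forall>\<phi>\<in>test_functions \<Omega>. u (\<lambda>x. c * \<phi> x) = c * u \<phi>) \<and>
     continuous_test_seminorm \<Omega> (\<lambda>\<phi>. norm (u \<phi>))}"

text \<open>For a test function \<open>\<theta>\<close>, the product of a distribution \<open>u\<close> with \<open>\<theta>\<close> has compact support;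
  the formula below is its canonical extension to all smooth \<open>\<psi>\<close>, which need not themselves be
  test functions.\<close>

definition dist_mult ::
    "((real^'n \<Rightarrow> complex) \<Rightarrow> complex) \<Rightarrow> (real^'n \<Rightarrow> complex) \<Rightarrow> (real^'n \<Rightarrow> complex) \<Rightarrow> complex" where
  "dist_mult u \<theta> = (\<lambda>\<psi>. u (\<lambda>x. \<theta> x * \<psi> x))"

definition fourier :: "((real^'n \<Rightarrow> complex) \<Rightarrow> complex) \<Rightarrow> real^'n \<Rightarrow> complex" where
  "fourier w k = w (\<lambda>x. exp (- (\<i> * complex_of_real (k \<bullet> x))))"

text \<open>Seminorms take values in \<open>[0, \<infinity>]\<close>, so that no convention for unbounded suprema intervenes.\<close>

definition micro_seminorm ::
    "real \<Rightarrow> (real^'n) set \<Rightarrow> (real^'n \<Rightarrow> complex) \<Rightarrow> ((real^'n \<Rightarrow> complex) \<Rightarrow> complex) \<Rightarrow> ennreal" where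
  "micro_seminorm N V \<theta> u =
     (SUP k\<in>V. ennreal ((1 + norm k) powr N * norm (fourier (dist_mult u \<theta>) k)))"

text \<open>The library's \<open>cone\<close> and \<open>conic\<close> require stability under multiplication by 0 as well, which
  would exclude the open conic neighbourhoods needed below.\<close>

definition pos_cone :: "(real^'n) set \<Rightarrow> bool" where
  "pos_cone V \<longleftrightarrow> (\<forall>k\<in>V. \<forall>c>0. c *\<^sub>R k \<in> V)"

definition wave_front_set ::
    "(real^'n) set \<Rightarrow> ((real^'n \<Rightarrow> complex) \<Rightarrow> complex) \<Rightarrow> ((real^'n) \<times> (real^'n)) set" where
  "wave_front_set \<Omega> u = {(x, \<xi>). x \<in> \<Omega> \<and> \<xi> \<noteq> 0 \<and>
     \<not> (\<exists>\<theta>\<in>test_functions \<Omega>. \<exists>V. \<theta> x \<noteq> 0 \<and> open V \<and> pos_cone V \<and> \<xi> \<in> V \<and>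
          (\<forall>N::nat. micro_seminorm (real N) V \<theta> u < \<infinity>))}"

definition closed_cotangent_cone ::
    "(real^'n) set \<Rightarrow> ((real^'n) \<times> (real^'n)) set \<Rightarrow> bool" where
  "closed_cotangent_cone \<Omega> \<Gamma> \<longleftrightarrow>
     closedin (top_of_set (\<Omega> \<times> (UNIV - {0}))) \<Gamma> \<and>
     (\<forall>(x, \<xi>)\<in>\<Gamma>. \<forall>c>0. (x, c *\<^sub>R \<xi>) \<in> \<Gamma>)"

definition distributions_WF ::
    "(real^'n) set \<Rightarrow> ((real^'n) \<times> (real^'n)) set \<Rightarrow> ((real^'n \<Rightarrow> complex) \<Rightarrow> complex) set" where
  "distributions_WF \<Omega> \<Gamma> = {u \<in> distributions \<Omega>. wave_front_set \<Omega> u \<subseteq> \<Gamma>}"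


section \<open>The normal topology\<close>

definition seminorm_topology :: "'v::minus set \<Rightarrow> ('v \<Rightarrow> ennreal) set \<Rightarrow> 'v topology" where
  "seminorm_topology X P = topology_generated_by
     (insert X {{v \<in> X. p (v - u) < ennreal e} | p u e. p \<in> P \<and> u \<in> X \<and> 0 < e})"

definition strong_seminorms ::
    "(real^'n) set \<Rightarrow> (((real^'n \<Rightarrow> complex) \<Rightarrow> complex) \<Rightarrow> ennreal) set" where
  "strong_seminorms \<Omega> =
     {(\<lambda>u. SUP \<phi>\<in>B. ennreal (norm (u \<phi>))) | B. bounded_test_set \<Omega> B}"

definition admissible_pair ::
    "(real^'n) set \<Rightarrow> ((real^'n) \<times> (real^'n)) set \<Rightarrow> (real^'n \<Rightarrow> complex) \<Rightarrow> (real^'n) set \<Rightarrow> bool" where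
  "admissible_pair \<Omega> \<Gamma> \<theta> V \<longleftrightarrow>
     \<theta> \<in> test_functions \<Omega> \<and> closed V \<and> pos_cone V \<and> (supp \<theta> \<times> V) \<inter> \<Gamma> = {}"

definition normal_topology ::
    "(real^'n) set \<Rightarrow> ((real^'n) \<times> (real^'n)) set \<Rightarrow> ((real^'n \<Rightarrow> complex) \<Rightarrow> complex) topology" where
  "normal_topology \<Omega> \<Gamma> = seminorm_topology (distributions_WF \<Omega> \<Gamma>)
     (strong_seminorms \<Omega> \<union>
      {micro_seminorm N V \<theta> | N V \<theta>. 0 \<le> N \<and> admissible_pair \<Omega> \<Gamma> \<theta> V})"

end

(*
  A test function phi supported where a bump function theta equals 1 is expanded into its Fourier
  series on a box around the support of theta. Multiplying by exp(-ik.x) and truncating the series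
  at frequencies |m| <= delta |k| splits the Fourier transform of phi u at k into finitely many
  values of the Fourier transform of theta u at points k - m of a slightly larger cone, and a
  remainder u(theta exp(-ik.x) (phi - T)), where phi - T decays rapidly in |k| together with all its
  derivatives; the weighted remainders therefore form a bounded set of test functions. Hence
  ||.||_{N,V,phi} is dominated by one seminorm of the strong topology and one seminorm
  ||.||_{P,W,theta} whenever V perturbed by delta stays in W. By compactness every admissible
  (chi, V) decomposes into finitely many such pieces, with theta and W from a countable list:
  bumps at the points of a countable dense set, and cones of directions at distance at least 1/j
  from Gamma over the ball supporting the bump.
*)
theory Submission
  imports Defs
begin

section \<open>Calculus of smooth functions\<close>

text \<open>The usual comparison of two localizations convolves Fourier transforms and controls the
  far frequencies by the polynomial growth of the transform of theta u. The order of that growth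
  depends on u, so by itself it gives no bound by fixed seminorms. Here the far part is never
  evaluated frequency by frequency: for each k it is a single test function chosen independently of
  u. Truncation also makes the splitting a finite identity, which linearity alone can exploit, so it
  applies directly to the differences v - u that define neighbourhoods. The cutoff proportional to
  |k| is forced from both sides: it must be small enough for k - m to stay in the larger cone, and
  large enough for rapid decay in the cutoff to be rapid decay in |k|. About |k|^n frequencies are
  kept, so the weight exponent rises by n. The box has side 2 pi, which makes the frequencies
  integral. The expanded function vanishes on its faces together with all derivatives; hence
  integration by parts has no boundary terms and differentiation commutes with truncation.\<close>

lemma partial_deriv_eqI:
  assumes "(f has_derivative f') (at x)"
  shows "partial_deriv i f x = f' (axis i 1)"
  using frechet_derivative_at[OF assms] by (simp add: partial_deriv_def)

lemma iter_partial_append: "iter_partial (ds @ es) f = iter_partial ds (iter_partial es f)"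
  by (induction ds) auto

lemma smooth_differentiable: "smooth f \<Longrightarrow> f differentiable (at x)"
  unfolding smooth_def by (metis iter_partial.simps(1))

lemma smooth_iter_partial: "smooth f \<Longrightarrow> smooth (iter_partial ds f)"
  unfolding smooth_def by (metis iter_partial_append)

lemma smooth_partial_deriv: "smooth f \<Longrightarrow> smooth (partial_deriv i f)"
  using smooth_iter_partial[of f "[i]"] by simp

lemma smooth_continuous_on: "smooth f \<Longrightarrow> continuous_on S f"
  by (meson continuous_at_imp_continuous_on differentiable_imp_continuous_within smooth_differentiable)

lemma smooth_has_derivative: "smooth f \<Longrightarrow> (f has_derivative frechet_derivative f (at x)) (at x)"
  using frechet_derivative_works smooth_differentiable by blast

text \<open>A class of differentiable functions closed under \<open>partial_deriv\<close> contains
  every iterated derivative of its members, so no formula for higher derivatives has to be written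
  down.\<close>

lemma smooth_coinduct:
  assumes "f \<in> A" and "\<And>f x. f \<in> A \<Longrightarrow> f differentiable (at x)"
    and "\<And>f i. f \<in> A \<Longrightarrow> partial_deriv i f \<in> A"
  shows "smooth f"
proof -
  have "iter_partial ds f \<in> A" for ds
    by (induction ds) (use assms in auto)
  then show ?thesis using assms(2) by (auto simp: smooth_def)
qed

section \<open>Smoothness of sums, products and compositions\<close>

lemma partial_deriv_add:
  assumes "f differentiable (at x)" "g differentiable (at x)"
  shows "partial_deriv i (\<lambda>x. f x + g x) x = partial_deriv i f x + partial_deriv i g x"
  using partial_deriv_eqI[OF has_derivative_add[OF assms[unfolded frechet_derivative_works]]]
  by (simp add: partial_deriv_def)

lemma partial_deriv_mult:
  assumes "f differentiable (at x)" "g differentiable (at x)"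
  shows "partial_deriv i (\<lambda>x. f x * g x) x = partial_deriv i f x * g x + f x * partial_deriv i g x"
  using partial_deriv_eqI[OF has_derivative_mult[OF assms[unfolded frechet_derivative_works]]]
  by (simp add: partial_deriv_def)

inductive_set ring_closure :: "('a \<Rightarrow> complex) set \<Rightarrow> ('a \<Rightarrow> complex) set" for A where
  base: "f \<in> A \<Longrightarrow> f \<in> ring_closure A"
| add: "f \<in> ring_closure A \<Longrightarrow> g \<in> ring_closure A \<Longrightarrow> (\<lambda>x. f x + g x) \<in> ring_closure A"
| mult: "f \<in> ring_closure A \<Longrightarrow> g \<in> ring_closure A \<Longrightarrow> (\<lambda>x. f x * g x) \<in> ring_closure A"

text \<open>The sum and product rules express derivatives of ring elements through ring elements, so
  only generators need checking. This takes the place of the Leibniz and Faa di Bruno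
  formulas.\<close>

lemma smooth_ring_closure:
  assumes f: "f \<in> ring_closure A"
    and diff: "\<And>f x. f \<in> A \<Longrightarrow> f differentiable (at x)"
    and part: "\<And>f i. f \<in> A \<Longrightarrow> partial_deriv i f \<in> ring_closure A"
  shows "smooth f"
proof (rule smooth_coinduct[OF f])
  show D: "f differentiable (at x)" if "f \<in> ring_closure A" for f x
    using that by induction (auto intro: diff)
  show "partial_deriv i f \<in> ring_closure A" if "f \<in> ring_closure A" for f i
    using that
  proof induction
    case (add f g)
    then have "partial_deriv i (\<lambda>x. f x + g x) = (\<lambda>x. partial_deriv i f x + partial_deriv i g x)"
      using D by (intro ext partial_deriv_add) auto
    with add show ?case by (simp add: ring_closure.add)
  next
    case (mult f g)
    then have "partial_deriv i (\<lambda>x. f x * g x) =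
        (\<lambda>x. partial_deriv i f x * g x + f x * partial_deriv i g x)"
      using D by (intro ext partial_deriv_mult) auto
    with mult show ?case by (simp add: ring_closure.add ring_closure.mult)
  qed (rule part)
qed

lemma smooth_ring_closure_of_smooth:
  assumes "\<And>f. f \<in> A \<Longrightarrow> smooth f" "f \<in> ring_closure A"
  shows "smooth f"
\<comment> \<open>Adding all iterated derivatives to the generators makes the generating set closed
  under \<open>partial_deriv\<close>.\<close>
proof (rule smooth_ring_closure[where A="{iter_partial ds f | ds f. f \<in> A}"])
  have "iter_partial [] f \<in> {iter_partial ds f | ds f. f \<in> A}" if "f \<in> A" for f
    using that by blast
  then have "A \<subseteq> {iter_partial ds f | ds f. f \<in> A}" by auto
  then show "f \<in> ring_closure {iter_partial ds f | ds f. f \<in> A}"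
    by (induction rule: ring_closure.induct[OF assms(2)])
      (blast intro: ring_closure.base, rule ring_closure.add, assumption+, rule ring_closure.mult, assumption+)
  show "f differentiable (at x)" if "f \<in> {iter_partial ds f | ds f. f \<in> A}" for f x
    using that assms(1) by (auto simp: smooth_def)
  show "partial_deriv i f \<in> ring_closure {iter_partial ds f | ds f. f \<in> A}"
    if f: "f \<in> {iter_partial ds f | ds f. f \<in> A}" for f i
  proof -
    from f obtain ds g where "f = iter_partial ds g" "g \<in> A" by blast
    then have "partial_deriv i f = iter_partial (i # ds) g" "g \<in> A" by auto
    then show ?thesis by (blast intro: ring_closure.base)
  qed
qed

lemma smooth_add: "smooth f \<Longrightarrow> smooth g \<Longrightarrow> smooth (\<lambda>x. f x + g x)"
proof (rule smooth_ring_closure_of_smooth[where A="{f, g}"])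
  show "(\<lambda>x. f x + g x) \<in> ring_closure {f, g}"
    by (rule ring_closure.add; rule ring_closure.base) simp_all
qed auto

lemma smooth_mult: "smooth f \<Longrightarrow> smooth g \<Longrightarrow> smooth (\<lambda>x. f x * g x)"
proof (rule smooth_ring_closure_of_smooth[where A="{f, g}"])
  show "(\<lambda>x. f x * g x) \<in> ring_closure {f, g}"
    by (rule ring_closure.mult; rule ring_closure.base) simp_all
qed auto

lemma smooth_const: "smooth (\<lambda>x. c)"
proof (rule smooth_coinduct[where A="range (\<lambda>c x. c)"])
  show "partial_deriv i f \<in> range (\<lambda>c x. c)" if "f \<in> range (\<lambda>c x. c)" for f :: "real^'n \<Rightarrow> complex" and i
  proof -
    from that obtain c where "f = (\<lambda>x. c)" by blast
    then have "partial_deriv i f = (\<lambda>x. 0)"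
      by (intro ext) (simp add: partial_deriv_eqI[OF has_derivative_const])
    then show ?thesis by blast
  qed
qed auto

lemma smooth_diff: "smooth f \<Longrightarrow> smooth g \<Longrightarrow> smooth (\<lambda>x. f x - g x)"
  using smooth_add[of f "\<lambda>x. (-1) * g x"] smooth_mult[OF smooth_const, of g "-1"] by simp

lemma smooth_sum: "(\<And>j. j \<in> J \<Longrightarrow> smooth (f j)) \<Longrightarrow> smooth (\<lambda>x. \<Sum>j\<in>J. f j x)"
  by (induction J rule: infinite_finite_induct) (simp_all add: smooth_const smooth_add)

lemma iter_partial_add:
  assumes "smooth f" "smooth g"
  shows "iter_partial ds (\<lambda>x. f x + g x) = (\<lambda>x. iter_partial ds f x + iter_partial ds g x)"
proof (induction ds)
  case (Cons i ds)
  have "partial_deriv i (\<lambda>x. iter_partial ds f x + iter_partial ds g x) =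
      (\<lambda>x. partial_deriv i (iter_partial ds f) x + partial_deriv i (iter_partial ds g) x)"
    using assms by (intro ext partial_deriv_add) (simp_all add: smooth_def)
  with Cons show ?case by simp
qed auto

lemma smooth_coordinate: "smooth (\<lambda>x :: real^'n. complex_of_real (x $ j))"
proof (rule smooth_ring_closure[where A="insert (\<lambda>x. complex_of_real (x $ j)) (range (\<lambda>c x. c))"])
  have d: "((\<lambda>x :: real^'n. complex_of_real (x $ j)) has_derivative (\<lambda>h. complex_of_real (h $ j))) (at x)" for x
    by (intro bounded_linear_imp_has_derivative bounded_linear_compose[OF bounded_linear_of_real] bounded_linear_vec_nth)
  show "f differentiable (at x)" if "f \<in> insert (\<lambda>x. complex_of_real (x $ j)) (range (\<lambda>c x. c))" for f :: "real^'n \<Rightarrow> complex" and x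
    using that d by (elim insertE imageE) (simp_all add: differentiableI[OF d])
  have "partial_deriv i (\<lambda>x. complex_of_real (x $ j)) = (\<lambda>x. complex_of_real (axis i 1 $ j))" for i
    by (intro ext partial_deriv_eqI d)
  moreover have "partial_deriv i (\<lambda>x::real^'n. c) = (\<lambda>x. 0)" for i c
    by (intro ext partial_deriv_eqI[OF has_derivative_const])
  ultimately show "partial_deriv i f \<in> ring_closure (insert (\<lambda>x. complex_of_real (x $ j)) (range (\<lambda>c x. c)))"
    if "f \<in> insert (\<lambda>x. complex_of_real (x $ j)) (range (\<lambda>c x. c))" for f i
    using that by (intro ring_closure.base) auto
qed (rule ring_closure.base, simp)

text \<open>By the chain rule, the functions \<open>G m (w x)\<close> for all m, together with all
  iterated derivatives of w, generate a ring closed under differentiation. The hypothesis asks for a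
  sequence of successive derivatives because \<open>flat\<close> comes in this form.\<close>

lemma smooth_compose:
  fixes G :: "nat \<Rightarrow> real \<Rightarrow> real"
  assumes G: "\<And>m t. (G m has_real_derivative G (Suc m) t) (at t)"
    and w: "smooth (\<lambda>x. complex_of_real (w x))"
  shows "smooth (\<lambda>x. complex_of_real (G m (w x)))"
proof -
  define A where "A = range (\<lambda>m x. complex_of_real (G m (w x))) \<union> range (\<lambda>ds. iter_partial ds (\<lambda>x. complex_of_real (w x)))"
  have w_diff: "w differentiable (at x)" for x
    using has_derivative_Re[OF smooth_has_derivative[OF w, of x]] by (auto simp: differentiable_def)
  have d: "((\<lambda>x. complex_of_real (G m (w x))) has_derivative
      (\<lambda>h. complex_of_real (frechet_derivative w (at x) h * G (Suc m) (w x)))) (at x)" for m x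
    by (intro has_derivative_of_real DERIV_compose_FDERIV[OF G] w_diff[unfolded frechet_derivative_works])
  have dw: "((\<lambda>x. complex_of_real (w x)) has_derivative
      (\<lambda>h. complex_of_real (frechet_derivative w (at x) h))) (at x)" for x
    by (intro has_derivative_of_real w_diff[unfolded frechet_derivative_works])
  have pd: "partial_deriv i (\<lambda>x. complex_of_real (G m (w x))) =
      (\<lambda>x. partial_deriv i (\<lambda>x. complex_of_real (w x)) x * complex_of_real (G (Suc m) (w x)))" for i m
    by (intro ext) (simp add: partial_deriv_eqI[OF d] partial_deriv_eqI[OF dw])
  have pA: "iter_partial ds (\<lambda>x. complex_of_real (w x)) \<in> A" for ds
    by (auto simp: A_def)
  have GA: "(\<lambda>x. complex_of_real (G m (w x))) \<in> A" for m
    by (auto simp: A_def)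
  show ?thesis
  proof (rule smooth_ring_closure[where A=A])
    show "f differentiable (at x)" if "f \<in> A" for f x
      using that unfolding A_def
    proof (elim UnE imageE)
      fix m assume "f = (\<lambda>x. complex_of_real (G m (w x)))"
      then show ?thesis using differentiableI[OF d] by simp
    next
      fix ds assume "f = iter_partial ds (\<lambda>x. complex_of_real (w x))"
      then show ?thesis using w by (simp add: smooth_def)
    qed
    show "partial_deriv i f \<in> ring_closure A" if "f \<in> A" for f i
      using that[unfolded A_def]
    proof (elim UnE imageE)
      fix m assume f: "f = (\<lambda>x. complex_of_real (G m (w x)))"
      show ?thesis unfolding f pd
        using pA[of "[i]"] GA by (intro ring_closure.mult ring_closure.base) auto
    next
      fix ds assume "f = iter_partial ds (\<lambda>x. complex_of_real (w x))"
      then show ?thesis using pA[of "i # ds"] by (simp add: ring_closure.base)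
    qed
  qed (rule ring_closure.base[OF GA])
qed

section \<open>Plane waves and their derivatives\<close>

definition character :: "real^'n \<Rightarrow> real^'n \<Rightarrow> complex" where
  "character k x = exp (- (\<i> * complex_of_real (k \<bullet> x)))"

lemma character_add: "character (k + l) x = character k x * character l x"
  by (simp add: character_def inner_add_left exp_add[symmetric] algebra_simps)

lemma norm_character [simp]: "norm (character k x) = 1"
  by (simp add: character_def)

lemma character_has_derivative:
  "((\<lambda>x. c * character k x) has_derivative (\<lambda>h. - \<i> * of_real (k \<bullet> h) * (c * character k x))) (at x)"
proof -
  have "((\<lambda>x. k \<bullet> x) has_derivative (\<lambda>h. k \<bullet> h)) (at x)"
    by (rule bounded_linear_imp_has_derivative[OF bounded_linear_inner_right])
  then have "((\<lambda>x. - (\<i> * complex_of_real (k \<bullet> x))) has_derivative (\<lambda>h. - (\<i> * complex_of_real (k \<bullet> h)))) (at x)"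
    by (intro has_derivative_minus has_derivative_mult_right has_derivative_of_real)
  from has_derivative_compose[OF this DERIV_exp[unfolded has_field_derivative_def]]
  have "((\<lambda>x. character k x) has_derivative (\<lambda>h. character k x * - (\<i> * complex_of_real (k \<bullet> h)))) (at x)"
    by (simp add: character_def)
  from has_derivative_mult_right[OF this, of c] show ?thesis
    by (simp add: algebra_simps)
qed

lemma partial_deriv_character:
  "partial_deriv i (\<lambda>x. c * character k x) = (\<lambda>x. (- \<i> * of_real (k $ i) * c) * character k x)"
  by (intro ext) (simp add: partial_deriv_eqI[OF character_has_derivative] inner_axis)

lemma smooth_scaled_character: "smooth (\<lambda>x. c * character k x)"
proof (rule smooth_coinduct[where A="range (\<lambda>c x. c * character k x)"])
  show "f differentiable (at x)" if "f \<in> range (\<lambda>c x. c * character k x)" for f x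
    using that by (elim imageE) (simp only: differentiableI[OF character_has_derivative])
  show "partial_deriv i f \<in> range (\<lambda>c x. c * character k x)" if "f \<in> range (\<lambda>c x. c * character k x)" for f i
    using that by (elim imageE) (simp only: partial_deriv_character, rule rangeI)
qed (rule rangeI)

lemma smooth_character: "smooth (character k)"
  using smooth_scaled_character[of 1 k] by simp

text \<open>Multiples of a character are stable under differentiation, and each derivative
  contributes a factor -i k_i. The decay of the Fourier remainder will have to absorb these powers
  of |k|.\<close>

lemma norm_iter_partial_character:
  "norm (iter_partial ds (character k) x) \<le> norm k ^ length ds"
proof -
  have "\<exists>c. iter_partial ds (character k) = (\<lambda>x. c * character k x) \<and> norm c \<le> norm k ^ length ds"
  proof (induction ds)
    case Nil
    show ?case by (intro exI[of _ 1]) auto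
  next
    case (Cons i ds)
    then obtain c where c: "iter_partial ds (character k) = (\<lambda>x. c * character k x)" "norm c \<le> norm k ^ length ds"
      by blast
    then have "iter_partial (i # ds) (character k) = (\<lambda>x. (- \<i> * of_real (k $ i) * c) * character k x)"
      by (simp add: partial_deriv_character)
    moreover have "norm (- \<i> * of_real (k $ i) * c) \<le> norm k ^ length (i # ds)"
      using c(2) component_le_norm_cart[of k i] by (auto simp: norm_mult intro!: mult_mono)
    ultimately show ?case by blast
  qed
  then show ?thesis by (auto simp: norm_mult)
qed

text \<open>Peeling off the innermost derivative keeps the factors arbitrary smooth functions, so the
  induction never has to enumerate the terms of the Leibniz formula.\<close>

lemma norm_iter_partial_mult:
  assumes "smooth f" "smooth g"
    and "\<And>es. length es \<le> length ds \<Longrightarrow> norm (iter_partial es f x) \<le> A"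
    and "\<And>es. length es \<le> length ds \<Longrightarrow> norm (iter_partial es g x) \<le> B"
  shows "norm (iter_partial ds (\<lambda>x. f x * g x) x) \<le> 2 ^ length ds * (A * B)"
  using assms
proof (induction ds arbitrary: f g rule: rev_induct)
  case Nil
  from Nil(3)[of "[]"] Nil(4)[of "[]"] have "norm (f x) \<le> A" "norm (g x) \<le> B" by auto
  moreover from this have "0 \<le> A" using norm_ge_zero order_trans by blast
  ultimately show ?case by (simp add: norm_mult mult_mono)
next
  case (snoc i ds)
  have pd: "partial_deriv i (\<lambda>x. f x * g x) = (\<lambda>x. partial_deriv i f x * g x + f x * partial_deriv i g x)"
    using snoc.prems by (intro ext partial_deriv_mult smooth_differentiable)
  have shift: "iter_partial es (partial_deriv i h) = iter_partial (es @ [i]) h" for es h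
    by (simp add: iter_partial_append)
  have "iter_partial (ds @ [i]) (\<lambda>x. f x * g x) x =
      iter_partial ds (\<lambda>x. partial_deriv i f x * g x) x + iter_partial ds (\<lambda>x. f x * partial_deriv i g x) x"
    using snoc.prems by (simp add: iter_partial_append pd iter_partial_add smooth_mult smooth_partial_deriv)
  also have "norm \<dots> \<le> 2 ^ length ds * (A * B) + 2 ^ length ds * (A * B)"
    using snoc.prems
    by (intro norm_triangle_mono snoc.IH smooth_partial_deriv) (auto simp: shift)
  finally show ?case by (simp add: mult_ac)
qed

section \<open>Supports\<close>

lemma supp_mult: "supp (\<lambda>x. f x * g x) \<subseteq> supp f"
  unfolding supp_def by (rule closure_mono) auto

lemma not_in_supp: "x \<notin> supp f \<Longrightarrow> f x = 0"
  unfolding supp_def using closure_subset[of "{x. f x \<noteq> 0}"] by blast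

lemma supp_subsetI: "closed K \<Longrightarrow> (\<And>x. x \<notin> K \<Longrightarrow> f x = 0) \<Longrightarrow> supp f \<subseteq> K"
  unfolding supp_def by (rule closure_minimal) auto

lemma supp_partial_deriv: "supp (partial_deriv i f) \<subseteq> supp f"
proof (rule supp_subsetI)
  fix x assume x: "x \<notin> supp f"
  have "open (- supp f)" by (simp add: supp_def open_Compl)
  then have "(f has_derivative (\<lambda>h. 0)) (at x)"
    using x has_derivative_transform_within_open[OF has_derivative_const[of 0 "at x"], of "- supp f" f]
    by (simp add: not_in_supp)
  then show "partial_deriv i f x = 0"
    by (rule partial_deriv_eqI)
qed (simp add: supp_def)

lemma supp_iter_partial: "supp (iter_partial ds f) \<subseteq> supp f"
proof (induction ds)
  case (Cons i ds)
  then show ?case using supp_partial_deriv[of i "iter_partial ds f"] by simp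
qed simp

section \<open>Fourier series of smooth functions of one variable\<close>

text \<open>These are the coefficients of the 2 pi-periodic extension of f restricted to the
  interval of length 2 pi centred at a; f itself need not be periodic.\<close>

definition fourier_coeff :: "real \<Rightarrow> int \<Rightarrow> (real \<Rightarrow> complex) \<Rightarrow> complex" where
  "fourier_coeff a m f = integral {a-pi..a+pi} (\<lambda>t. cis (- (of_int m * t)) * f t) / of_real (2 * pi)"

lemma cis_has_vector_derivative [derivative_intros]:
  "((\<lambda>t. cis (c * t)) has_vector_derivative (\<i> * of_real c * cis (c * t))) (at t within S)"
proof -
  have "((\<lambda>z. exp (\<i> * of_real c * z)) has_field_derivative \<i> * of_real c * exp (\<i> * of_real c * of_real t)) (at (of_real t))"
    by (auto intro!: derivative_eq_intros)
  from has_vector_derivative_real_field[OF this, of S]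
  show ?thesis by (simp add: cis_conv_exp mult_ac)
qed

lemma cis_int_period: "cis (of_int m * (a + pi)) = cis (of_int m * (a - pi))"
proof -
  have "cis (of_int m * (a + pi)) = cis (of_int m * (a - pi)) * cis (2 * pi * of_int m)"
    by (simp add: cis_mult algebra_simps)
  then show ?thesis by (simp add: cis_multiple_2pi)
qed

lemma has_integral_cis_period:
  "((\<lambda>t. cis (of_int m * t)) has_integral (if m = 0 then of_real (2 * pi) else 0)) {a-pi..a+pi}"
proof (cases "m = 0")
  case True
  then show ?thesis
    using has_integral_const_real[of "1 :: complex" "a - pi" "a + pi"] by (simp add: scaleR_conv_of_real)
next
  case False
  have "((\<lambda>t. \<i> * of_int m * cis (of_int m * t)) has_integral
      cis (of_int m * (a + pi)) - cis (of_int m * (a - pi))) {a-pi..a+pi}"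
    by (rule fundamental_theorem_of_calculus) (use cis_has_vector_derivative[of "of_int m"] in auto)
  then have "((\<lambda>t. \<i> * of_int m * cis (of_int m * t)) has_integral 0) {a-pi..a+pi}"
    by (simp add: cis_int_period)
  from has_integral_mult_right[OF this, of "1 / (\<i> * of_int m)"] False show ?thesis by simp
qed

lemma norm_fourier_coeff_le:
  assumes "continuous_on {a-pi..a+pi} f" "\<And>t. t \<in> {a-pi..a+pi} \<Longrightarrow> norm (f t) \<le> A"
  shows "norm (fourier_coeff a m f) \<le> A"
proof -
  have "norm (integral {a-pi..a+pi} (\<lambda>t. cis (- (of_int m * t)) * f t)) \<le> A * (a + pi - (a - pi))"
    using assms by (intro integral_bound) (auto intro!: continuous_intros simp: norm_mult)
  then show ?thesis
    by (simp add: fourier_coeff_def norm_divide divide_le_eq)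
qed

lemma fourier_coeff_integrable:
  "continuous_on {a-pi..a+pi} f \<Longrightarrow> (\<lambda>t. cis (- (of_int m * t)) * f t) integrable_on {a-pi..a+pi}"
  by (intro integrable_continuous_interval continuous_intros)

text \<open>Integration by parts: the boundary terms cancel because f and the exponential of integer
  frequency both take equal values at the two ends.\<close>

lemma fourier_coeff_deriv:
  assumes d: "\<And>t. t \<in> {a-pi..a+pi} \<Longrightarrow> (f has_vector_derivative f' t) (at t within {a-pi..a+pi})"
    and c: "continuous_on {a-pi..a+pi} f'" and e: "f (a - pi) = f (a + pi)"
  shows "fourier_coeff a m f' = \<i> * of_int m * fourier_coeff a m f"
proof -
  have cf: "continuous_on {a-pi..a+pi} f"
    unfolding continuous_on_eq_continuous_within using has_vector_derivative_continuous[OF d] by blast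
  have "((\<lambda>t. cis (- (of_int m * t)) * f' t - \<i> * of_int m * (cis (- (of_int m * t)) * f t)) has_integral
      cis (- (of_int m * (a + pi))) * f (a + pi) - cis (- (of_int m * (a - pi))) * f (a - pi)) {a-pi..a+pi}"
  proof (rule fundamental_theorem_of_calculus)
    fix t assume t: "t \<in> {a-pi..a+pi}"
    show "((\<lambda>t. cis (- (of_int m * t)) * f t) has_vector_derivative
        cis (- (of_int m * t)) * f' t - \<i> * of_int m * (cis (- (of_int m * t)) * f t)) (at t within {a-pi..a+pi})"
      using has_vector_derivative_mult[OF cis_has_vector_derivative[of "- of_int m"] d[OF t]]
      by (simp add: algebra_simps)
  qed simp
  moreover have "cis (- (of_int m * (a + pi))) = cis (- (of_int m * (a - pi)))"
    using cis_int_period[of "-m" a] by simp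
  ultimately have 1: "integral {a-pi..a+pi} (\<lambda>t. cis (- (of_int m * t)) * f' t - \<i> * of_int m * (cis (- (of_int m * t)) * f t)) = 0"
    using e by (auto intro: integral_unique)
  have "integral {a-pi..a+pi} (\<lambda>t. cis (- (of_int m * t)) * f' t - \<i> * of_int m * (cis (- (of_int m * t)) * f t))
    = integral {a-pi..a+pi} (\<lambda>t. cis (- (of_int m * t)) * f' t) -
      \<i> * of_int m * integral {a-pi..a+pi} (\<lambda>t. cis (- (of_int m * t)) * f t)"
    by (subst integral_diff)
      (auto intro!: fourier_coeff_integrable c cf integrable_on_mult_right)
  with 1 show ?thesis by (simp add: fourier_coeff_def)
qed

lemma fourier_coeff_decay:
  assumes d: "\<And>l t. (G l has_vector_derivative G (Suc l) t) (at t)"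
    and e: "\<And>l. G l (a - pi) = G l (a + pi)"
    and A: "\<And>t. t \<in> {a-pi..a+pi} \<Longrightarrow> norm (G M t) \<le> A"
  shows "\<bar>of_int m\<bar> ^ M * norm (fourier_coeff a m (G 0)) \<le> A"
proof -
  have cont: "continuous_on {a-pi..a+pi} (G l)" for l
    using d[THEN has_vector_derivative_continuous] by (simp add: continuous_at_imp_continuous_on)
  have "fourier_coeff a m (G l) = (\<i> * of_int m) ^ l * fourier_coeff a m (G 0)" for l
  proof (induction l)
    case (Suc l)
    have "fourier_coeff a m (G (Suc l)) = \<i> * of_int m * fourier_coeff a m (G l)"
      by (rule fourier_coeff_deriv) (auto intro: has_vector_derivative_at_within d e cont)
    with Suc show ?case by simp
  qed simp
  from this[of M] have "norm (fourier_coeff a m (G M)) = \<bar>of_int m\<bar> ^ M * norm (fourier_coeff a m (G 0))"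
    by (simp add: norm_mult norm_power)
  with norm_fourier_coeff_le[OF cont A] show ?thesis by metis
qed

text \<open>Expand 0 \<le> integral of |g - s|^2, where s is the trigonometric polynomial with the
  coefficients of g on F: by orthogonality the integrals of g times the conjugate of s and of |s|^2
  are both 2 pi N. The finite set F is arbitrary so that the bound can be used along any injective
  sequence of frequencies.\<close>

lemma fourier_coeff_bessel:
  assumes c: "continuous_on {a-pi..a+pi} g" and B: "\<And>t. t \<in> {a-pi..a+pi} \<Longrightarrow> norm (g t) \<le> B"
    and F: "finite F"
  shows "(\<Sum>m\<in>F. (norm (fourier_coeff a m g))\<^sup>2) \<le> B\<^sup>2"
proof -
  define I where "I = {a-pi..a+pi}"
  define \<gamma> where "\<gamma> m = fourier_coeff a m g" for m
  define s where "s t = (\<Sum>m\<in>F. \<gamma> m * cis (of_int m * t))" for t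
  define N where "N = (\<Sum>m\<in>F. (norm (\<gamma> m))\<^sup>2)"
  have cs: "continuous_on I s" unfolding s_def by (intro continuous_intros)
  have cg: "continuous_on I g" using c by (simp add: I_def)
  have coeff: "((\<lambda>t. cis (- (of_int m * t)) * g t) has_integral of_real (2 * pi) * \<gamma> m) I" for m
    using integrable_integral[OF fourier_coeff_integrable[OF c, of m]]
    by (simp add: \<gamma>_def fourier_coeff_def I_def)
  have gs: "((\<lambda>t. g t * cnj (s t)) has_integral of_real (2 * pi * N)) I"
  proof -
    have "((\<lambda>t. \<Sum>m\<in>F. cnj (\<gamma> m) * (cis (- (of_int m * t)) * g t)) has_integral
       (\<Sum>m\<in>F. cnj (\<gamma> m) * (of_real (2 * pi) * \<gamma> m))) I"
      by (intro has_integral_sum F has_integral_mult_right coeff)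
    also have "(\<lambda>t. \<Sum>m\<in>F. cnj (\<gamma> m) * (cis (- (of_int m * t)) * g t)) = (\<lambda>t. g t * cnj (s t))"
      by (simp add: s_def sum_distrib_left cis_cnj mult_ac)
    also have "(\<Sum>m\<in>F. cnj (\<gamma> m) * (of_real (2 * pi) * \<gamma> m)) = of_real (2 * pi * N)"
      by (simp add: N_def sum_distrib_left complex_norm_square mult_ac flip: of_real_power)
    finally show ?thesis .
  qed
  have "((\<lambda>t. s t * cnj (s t)) has_integral of_real (2 * pi * N)) I"
  proof -
    have "((\<lambda>t. \<Sum>m\<in>F. \<Sum>l\<in>F. (\<gamma> m * cnj (\<gamma> l)) * cis (of_int (m - l) * t)) has_integral
       (\<Sum>m\<in>F. \<Sum>l\<in>F. (\<gamma> m * cnj (\<gamma> l)) * (if m - l = 0 then of_real (2 * pi) else 0))) I"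
      unfolding I_def by (intro has_integral_sum F has_integral_mult_right has_integral_cis_period)
    also have "(\<lambda>t. \<Sum>m\<in>F. \<Sum>l\<in>F. (\<gamma> m * cnj (\<gamma> l)) * cis (of_int (m - l) * t)) = (\<lambda>t. s t * cnj (s t))"
    proof
      fix t
      have "s t * cnj (s t) = (\<Sum>m\<in>F. \<Sum>l\<in>F. (\<gamma> m * cis (of_int m * t)) * cnj (\<gamma> l * cis (of_int l * t)))"
        by (simp only: s_def cnj_sum sum_product)
      also have "\<dots> = (\<Sum>m\<in>F. \<Sum>l\<in>F. (\<gamma> m * cnj (\<gamma> l)) * (cis (of_int m * t) * cis (- (of_int l * t))))"
        by (simp add: cis_cnj mult_ac)
      also have "\<dots> = (\<Sum>m\<in>F. \<Sum>l\<in>F. (\<gamma> m * cnj (\<gamma> l)) * cis (of_int (m - l) * t))"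
        by (simp add: cis_mult algebra_simps)
      finally show "(\<Sum>m\<in>F. \<Sum>l\<in>F. (\<gamma> m * cnj (\<gamma> l)) * cis (of_int (m - l) * t)) = s t * cnj (s t)" by simp
    qed
    also have "(\<Sum>m\<in>F. \<Sum>l\<in>F. (\<gamma> m * cnj (\<gamma> l)) * (if m - l = 0 then of_real (2 * pi) else 0)) = of_real (2 * pi * N)"
      using F by (simp add: N_def sum_distrib_left complex_norm_square mult_ac if_distrib sum.delta
          cong: if_cong flip: of_real_power)
    finally show ?thesis .
  qed
  from has_integral_Re[OF this] have ss: "((\<lambda>t. Re (s t * cnj (s t))) has_integral 2 * pi * N) I" by simp
  from has_integral_Re[OF gs] have gs': "((\<lambda>t. Re (g t * cnj (s t))) has_integral 2 * pi * N) I" by simp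
  have gg: "((\<lambda>t. (norm (g t))\<^sup>2) has_integral integral I (\<lambda>t. (norm (g t))\<^sup>2)) I"
    unfolding I_def using c by (intro integrable_integral integrable_continuous_interval continuous_intros)
  have pointwise: "(norm (g t - s t))\<^sup>2 = (norm (g t))\<^sup>2 - 2 * Re (g t * cnj (s t)) + Re (s t * cnj (s t))" for t
    unfolding cmod_power2 by (simp add: power2_eq_square algebra_simps)
  have "((\<lambda>t. (norm (g t - s t))\<^sup>2) has_integral
      integral I (\<lambda>t. (norm (g t))\<^sup>2) - 2 * (2 * pi * N) + 2 * pi * N) I"
    unfolding pointwise by (intro has_integral_add has_integral_diff has_integral_mult_right gg gs' ss)
  then have "0 \<le> integral I (\<lambda>t. (norm (g t))\<^sup>2) - 2 * (2 * pi * N) + 2 * pi * N"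
    by (rule has_integral_nonneg) simp
  moreover have "integral I (\<lambda>t. (norm (g t))\<^sup>2) \<le> B\<^sup>2 * (2 * pi)"
  proof -
    have "norm (integral {a-pi..a+pi} (\<lambda>t. (norm (g t))\<^sup>2)) \<le> B\<^sup>2 * (a + pi - (a - pi))"
      using B by (intro integral_bound continuous_intros c) (auto intro: power_mono)
    then show ?thesis by (simp add: I_def)
  qed
  ultimately have "2 * pi * N \<le> 2 * pi * B\<^sup>2" by argo
  then have "N \<le> B\<^sup>2" by (subst (asm) mult_le_cancel_left_pos) auto
  then show ?thesis by (simp add: N_def \<gamma>_def)
qed

text \<open>Riemann-Lebesgue: by Bessel's inequality the squares are summable along the sequence, so
  its terms tend to 0.\<close>

lemma fourier_coeff_tendsto_zero:
  fixes j :: "nat \<Rightarrow> int"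
  assumes c: "continuous_on {a-pi..a+pi} g" and j: "inj j"
  shows "(\<lambda>n. fourier_coeff a (j n) g) \<longlonglongrightarrow> 0"
proof -
  have "compact (g ` {a-pi..a+pi})" by (intro compact_continuous_image c) simp
  then obtain B where B: "\<And>t. t \<in> {a-pi..a+pi} \<Longrightarrow> norm (g t) \<le> B"
    by (meson bounded_iff compact_imp_bounded imageI)
  have "(\<Sum>i<n. (norm (fourier_coeff a (j i) g))\<^sup>2) \<le> B\<^sup>2" for n
    using fourier_coeff_bessel[OF c B, of "j ` {..<n}"] j
    by (simp add: sum.reindex inj_on_subset)
  then have "summable (\<lambda>i. (norm (fourier_coeff a (j i) g))\<^sup>2)"
    by (intro summableI_nonneg_bounded) auto
  from tendsto_real_sqrt[OF summable_LIMSEQ_zero[OF this]] show ?thesis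
    by (simp add: tendsto_norm_zero_iff)
qed

section \<open>Pointwise convergence and rate of one-variable Fourier sums\<close>

definition fourier_sum :: "real \<Rightarrow> nat \<Rightarrow> (real \<Rightarrow> complex) \<Rightarrow> real \<Rightarrow> complex" where
  "fourier_sum a R f x = (\<Sum>m\<in>{-int R..int R}. cis (of_int m * x) * fourier_coeff a m f)"

lemma fourier_sum_Suc:
  "fourier_sum a (Suc R) f x = fourier_sum a R f x
     + cis (of_int (int (Suc R)) * x) * fourier_coeff a (int (Suc R)) f
     + cis (of_int (- int (Suc R)) * x) * fourier_coeff a (- int (Suc R)) f"
proof -
  have "{-int (Suc R)..int (Suc R)} = insert (int (Suc R)) (insert (- int (Suc R)) {-int R..int R})" by auto
  then show ?thesis unfolding fourier_sum_def by (simp add: algebra_simps)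
qed

text \<open>If \<open>f t - f x = (cis (t - x) - 1) * g t\<close>, the terms of the Fourier series of \<open>f - f x\<close> at \<open>x\<close>
  are differences of consecutive terms of that of \<open>g\<close>, so the partial sums telescope.\<close>

lemma fourier_sum_telescope:
  assumes cf: "continuous_on {a-pi..a+pi} f" and cg: "continuous_on {a-pi..a+pi} g"
    and fg: "\<And>t. t \<in> {a-pi..a+pi} \<Longrightarrow> f t - f x = (cis (t - x) - 1) * g t"
  shows "fourier_sum a R f x - f x = cis (of_int (- int R - 1) * x) * fourier_coeff a (- int R - 1) g
     - cis (of_int (int R) * x) * fourier_coeff a (int R) g"
proof -
  define G where "G m = cis (of_int m * x) * fourier_coeff a m g" for m
  have coeff: "fourier_coeff a m f - (if m = 0 then f x else 0) =
      cis (- x) * fourier_coeff a (m - 1) g - fourier_coeff a m g" for m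
  proof -
    have "((\<lambda>t. cis (- (of_int m * t)) * f t - cis (of_int (- m) * t) * f x) has_integral
       of_real (2 * pi) * fourier_coeff a m f - (if - m = 0 then of_real (2 * pi) else 0) * f x) {a-pi..a+pi}"
      using integrable_integral[OF fourier_coeff_integrable[OF cf, of m]]
      by (intro has_integral_diff has_integral_mult_left has_integral_cis_period)
         (simp add: fourier_coeff_def)
    note 1 = this
    have 2: "((\<lambda>t. cis (- x) * (cis (- (of_int (m - 1) * t)) * g t) - cis (- (of_int m * t)) * g t) has_integral
       cis (- x) * (of_real (2 * pi) * fourier_coeff a (m - 1) g) - of_real (2 * pi) * fourier_coeff a m g) {a-pi..a+pi}"
      using integrable_integral[OF fourier_coeff_integrable[OF cg, of m]]
        integrable_integral[OF fourier_coeff_integrable[OF cg, of "m - 1"]]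
      by (intro has_integral_diff has_integral_mult_right)
         (simp_all add: fourier_coeff_def)
    have 3: "cis (- (of_int m * t)) * f t - cis (of_int (- m) * t) * f x =
        cis (- x) * (cis (- (of_int (m - 1) * t)) * g t) - cis (- (of_int m * t)) * g t"
      if "t \<in> {a-pi..a+pi}" for t
    proof -
      have "cis (- (of_int m * t)) * f t - cis (of_int (- m) * t) * f x = cis (- (of_int m * t)) * (f t - f x)"
        by (simp add: algebra_simps)
      also have "\<dots> = (cis (- (of_int m * t)) * cis (t - x)) * g t - cis (- (of_int m * t)) * g t"
        by (simp add: fg[OF that] algebra_simps)
      also have "cis (- (of_int m * t)) * cis (t - x) = cis (- x) * cis (- (of_int (m - 1) * t))"
        by (simp add: cis_mult algebra_simps)
      finally show ?thesis by (simp add: mult_ac)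
    qed
    from has_integral_unique[OF has_integral_eq[OF 3 1] 2]
    have "of_real (2 * pi) * fourier_coeff a m f - (if - m = 0 then of_real (2 * pi) else 0) * f x
        = cis (- x) * (of_real (2 * pi) * fourier_coeff a (m - 1) g) - of_real (2 * pi) * fourier_coeff a m g"
      by simp
    then have "of_real (2 * pi) * (fourier_coeff a m f - (if m = 0 then f x else 0))
        = of_real (2 * pi) * (cis (- x) * fourier_coeff a (m - 1) g - fourier_coeff a m g)"
      by (simp add: algebra_simps)
    then show ?thesis by (subst (asm) mult_cancel_left) simp
  qed
  have step: "cis (of_int m * x) * fourier_coeff a m f = (if m = 0 then f x else 0) + (G (m - 1) - G m)" for m
  proof -
    have "cis (of_int m * x) * (fourier_coeff a m f - (if m = 0 then f x else 0)) =
       (cis (of_int m * x) * cis (- x)) * fourier_coeff a (m - 1) g - G m"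
      unfolding coeff by (simp add: G_def algebra_simps)
    also have "cis (of_int m * x) * cis (- x) = cis (of_int (m - 1) * x)"
      by (simp add: cis_mult algebra_simps)
    finally have "cis (of_int m * x) * (fourier_coeff a m f - (if m = 0 then f x else 0)) = G (m - 1) - G m"
      by (simp add: G_def)
    then show ?thesis by (cases "m = 0") (auto simp: algebra_simps)
  qed
  have "fourier_sum a R f x = f x + (G (- int R - 1) - G (int R))"
  proof (induction R)
    case 0
    then show ?case using step[of 0] by (simp add: fourier_sum_def)
  next
    case (Suc R)
    have "fourier_sum a (Suc R) f x = f x + (G (- int R - 1) - G (int R))
       + (G (int (Suc R) - 1) - G (int (Suc R))) + (G (- int (Suc R) - 1) - G (- int (Suc R)))"
      unfolding fourier_sum_Suc Suc step by simp
    also have "\<dots> = f x + (G (- int (Suc R) - 1) - G (int (Suc R)))"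
    proof -
      have "int (Suc R) - 1 = int R" "- int (Suc R) = - int R - 1" by simp_all
      then show ?thesis by (simp only:) simp
    qed
    finally show ?case .
  qed
  then show ?thesis by (simp add: G_def)
qed

lemma has_vector_derivative_quotient:
  assumes "(f has_vector_derivative D) (at x)"
  shows "((\<lambda>t. (f t - f x) / complex_of_real (t - x)) \<longlongrightarrow> D) (at x)"
  using assms unfolding tendsto_complex_iff Re_divide_of_real Im_divide_of_real
  by (simp add: has_vector_derivative_complex_iff has_field_derivative_iff)

text \<open>Convergence without the Dirichlet kernel: after telescoping, the error consists of two
  Fourier coefficients of the quotient g, of frequencies -R - 1 and R, and these tend to 0.\<close>

lemma fourier_sum_tendsto:
  assumes d: "\<And>t. (f has_vector_derivative f' t) (at t)" and x: "x \<in> {a-pi<..<a+pi}"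
  shows "(\<lambda>R. fourier_sum a R f x) \<longlonglongrightarrow> f x"
proof -
  \<comment> \<open>The value at x fills a removable singularity: near x the denominator behaves
    like i (t - x).\<close>
  define g where "g t = (if t = x then f' x / \<i> else (f t - f x) / (cis (t - x) - 1))" for t
  have cf: "continuous_on S f" for S
    using d[THEN has_vector_derivative_continuous] by (simp add: continuous_at_imp_continuous_on)
  \<comment> \<open>This uses that x is interior: for x at one end, the other end is at distance 2
    pi and the denominator would vanish there as well.\<close>
  have cis_ne: "cis (t - x) \<noteq> 1" if t: "t \<in> {a-pi..a+pi}" "t \<noteq> x" for t
  proof
    assume "cis (t - x) = 1"
    then obtain n :: int where n: "t - x = 2 * pi * of_int n"
      using cos_one_2pi_int[of "t - x"] by (auto simp: complex_eq_iff mult_ac)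
    have "\<bar>t - x\<bar> < 2 * pi" using t x by auto
    then have "2 * pi * \<bar>of_int n\<bar> < 2 * pi * 1" by (simp add: n abs_mult)
    then have "n = 0" by (subst (asm) mult_less_cancel_left_pos) auto
    with n t show False by simp
  qed
  have cg: "continuous_on {a-pi..a+pi} g"
  proof -
    have lim: "(g \<longlongrightarrow> g x) (at x)"
    proof -
      have "((\<lambda>t. cis (1 * t) * cis (- x)) has_vector_derivative \<i> * of_real 1 * cis (1 * x) * cis (- x)) (at x)"
        by (intro has_vector_derivative_mult_left cis_has_vector_derivative)
      then have "((\<lambda>t. cis (t - x)) has_vector_derivative \<i>) (at x)"
        by (simp add: cis_mult mult.assoc)
      from tendsto_divide[OF has_vector_derivative_quotient[OF d] has_vector_derivative_quotient[OF this]]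
      have "((\<lambda>t. ((f t - f x) / of_real (t - x)) / ((cis (t - x) - 1) / of_real (t - x))) \<longlongrightarrow> g x) (at x)"
        by (simp add: g_def)
      moreover have "eventually (\<lambda>t. ((f t - f x) / of_real (t - x)) / ((cis (t - x) - 1) / of_real (t - x)) = g t) (at x)"
        by (auto simp: eventually_at_filter g_def)
      ultimately show ?thesis by (rule Lim_transform_eventually)
    qed
    have "isCont g t" if t: "t \<in> {a-pi..a+pi}" "t \<noteq> x" for t
    proof -
      have "continuous_on UNIV (\<lambda>t. cis (t - x))" by (intro continuous_intros)
      then have "isCont (\<lambda>t. cis (t - x)) t" by (simp add: continuous_on_eq_continuous_at)
      then have "isCont (\<lambda>t. (f t - f x) / (cis (t - x) - 1)) t"
        using cis_ne[OF t] d[THEN has_vector_derivative_continuous, of t] by (intro continuous_intros) auto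
      moreover have "eventually (\<lambda>s. g s = (f s - f x) / (cis (s - x) - 1)) (nhds t)"
        using t1_space_nhds[OF t(2)] by eventually_elim (simp add: g_def)
      ultimately show ?thesis using isCont_cong[of g "\<lambda>t. (f t - f x) / (cis (t - x) - 1)" t] by simp
    qed
    with lim show ?thesis
      unfolding continuous_on_eq_continuous_within
      by (metis continuous_at_imp_continuous_at_within isCont_def)
  qed
  have fg: "f t - f x = (cis (t - x) - 1) * g t" if "t \<in> {a-pi..a+pi}" for t
    using cis_ne[OF that] by (auto simp: g_def)
  have lim: "(\<lambda>R. cis (of_int (j R) * x) * fourier_coeff a (j R) g) \<longlonglongrightarrow> 0" if "inj j" for j :: "nat \<Rightarrow> int"
    using tendsto_norm_zero[OF fourier_coeff_tendsto_zero[OF cg that]]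
    by (intro tendsto_norm_zero_cancel[where f = "\<lambda>R. cis (of_int (j R) * x) * fourier_coeff a (j R) g"])
       (simp add: norm_mult)
  have "(\<lambda>R. fourier_sum a R f x - f x) = (\<lambda>R. cis (of_int (- int R - 1) * x) * fourier_coeff a (- int R - 1) g
     - cis (of_int (int R) * x) * fourier_coeff a (int R) g)"
    by (intro ext fourier_sum_telescope cf cg fg)
  also have "\<dots> \<longlonglongrightarrow> 0 - 0"
    by (intro tendsto_diff lim) (auto simp: inj_def)
  finally have "(\<lambda>R. fourier_sum a R f x - f x) \<longlonglongrightarrow> 0" by simp
  then show ?thesis using LIM_zero_iff by blast
qed

text \<open>Pointwise convergence turns the error into the tail of the series. Of the p + 2
  integrations by parts, p give the rate and two make the tail summable.\<close>

lemma fourier_sum_error: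
  assumes d: "\<And>l t. (G l has_vector_derivative G (Suc l) t) (at t)"
    and e: "\<And>l. G l (a - pi) = G l (a + pi)"
    and A: "\<And>t. t \<in> {a-pi..a+pi} \<Longrightarrow> norm (G (p + 2) t) \<le> A"
    and x: "x \<in> {a-pi..a+pi}"
  shows "norm (G 0 x - fourier_sum a R (G 0) x) \<le> 4 * A / (1 + real R) ^ p"
proof -
  have A0: "0 \<le> A" by (rule order_trans[OF norm_ge_zero A[of a]]) simp
  have coeff: "norm (fourier_coeff a m (G 0)) \<le> A / \<bar>of_int m\<bar> ^ (p + 2)" if "m \<noteq> 0" for m
    using fourier_coeff_decay[where G=G and M="p + 2" and a=a and A=A and m=m, OF d e A] that
    by (simp add: pos_le_divide_eq mult_ac)
  \<comment> \<open>The subtracted fraction carries the induction: with r = 1 + R + n, the next pair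
    of frequencies costs a multiple of 1/r^2 \<le> 2 (1/r - 1/(r + 1)), which is the increment of
    the bound.\<close>
  have telescope: "norm (fourier_sum a (R + n) (G 0) y - fourier_sum a R (G 0) y)
      \<le> 4 * A / (1 + real R) ^ p * (1 / (1 + real R) - 1 / (1 + real (R + n)))" for n y
  proof (induction n)
    case (Suc n)
    define r where "r = 1 + real (R + n)"
    have r: "1 + real R \<le> r" "1 \<le> r" by (auto simp: r_def)
    have double: "2 * A / D * (2 * X) = 4 * A / D * X" for D X :: real by simp
    have "norm (fourier_sum a (Suc (R + n)) (G 0) y - fourier_sum a (R + n) (G 0) y)
       \<le> norm (fourier_coeff a (int (Suc (R + n))) (G 0)) + norm (fourier_coeff a (- int (Suc (R + n))) (G 0))"
      unfolding fourier_sum_Suc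
      by (rule order_trans[OF _ norm_triangle_ineq[THEN order_trans]]) (auto simp: norm_mult)
    also have "\<dots> \<le> A / r ^ (p + 2) + A / r ^ (p + 2)"
    proof (intro add_mono)
      have "\<bar>of_int (int (Suc (R + n)))\<bar> = r" "\<bar>of_int (- int (Suc (R + n)))\<bar> = r"
        by (simp_all add: r_def)
      from coeff[of "int (Suc (R + n))", unfolded this] coeff[of "- int (Suc (R + n))", unfolded this]
      show "norm (fourier_coeff a (int (Suc (R + n))) (G 0)) \<le> A / r ^ (p + 2)"
        "norm (fourier_coeff a (- int (Suc (R + n))) (G 0)) \<le> A / r ^ (p + 2)"
        by simp_all
    qed
    also have "\<dots> = 2 * A / r ^ p * (1 / r\<^sup>2)"
      by (simp add: power_add power2_eq_square)
    also have "\<dots> \<le> 2 * A / (1 + real R) ^ p * (2 * (1 / r - 1 / (r + 1)))"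
    proof (intro mult_mono divide_left_mono power_mono)
      show "1 / r\<^sup>2 \<le> 2 * (1 / r - 1 / (r + 1))"
      proof -
        have "r * (r + 1) \<le> 2 * r\<^sup>2"
          using r(2) mult_left_mono[of "r + 1" "2 * r" r] by (simp add: power2_eq_square)
        then have "2 / (2 * r\<^sup>2) \<le> 2 / (r * (r + 1))"
          using r(2) by (intro divide_left_mono mult_pos_pos) auto
        moreover have "2 * (1 / r - 1 / (r + 1)) = 2 / (r * (r + 1))"
          using r(2) by (simp add: divide_simps)
        ultimately show ?thesis by simp
      qed
    qed (use r A0 in auto)
    finally have "norm (fourier_sum a (Suc (R + n)) (G 0) y - fourier_sum a (R + n) (G 0) y)
       \<le> 4 * A / (1 + real R) ^ p * (1 / r - 1 / (r + 1))"
      by (simp only: double)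
    from norm_triangle_mono[OF this Suc[folded r_def], folded distrib_left]
    have "norm (fourier_sum a (Suc (R + n)) (G 0) y - fourier_sum a R (G 0) y)
      \<le> 4 * A / (1 + real R) ^ p * ((1 / r - 1 / (r + 1)) + (1 / (1 + real R) - 1 / r))"
      by simp
    then show ?case by (simp add: r_def add_ac)
  qed simp
  have interior: "norm (G 0 y - fourier_sum a R (G 0) y) \<le> 4 * A / (1 + real R) ^ p" if y: "y \<in> {a-pi<..<a+pi}" for y
  proof -
    have "(\<lambda>n. fourier_sum a (R + n) (G 0) y) \<longlonglongrightarrow> G 0 y"
      using LIMSEQ_ignore_initial_segment[OF fourier_sum_tendsto[OF d y], of R] by (simp add: add.commute)
    then have "(\<lambda>n. norm (fourier_sum a (R + n) (G 0) y - fourier_sum a R (G 0) y)) \<longlonglongrightarrow> norm (G 0 y - fourier_sum a R (G 0) y)"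
      by (intro tendsto_intros)
    moreover have "norm (fourier_sum a (R + n) (G 0) y - fourier_sum a R (G 0) y) \<le> 4 * A / (1 + real R) ^ p" for n
    proof -
      have "1 / (1 + real R) - 1 / (1 + real (R + n)) \<le> 1"
        by (rule order_trans[of _ "1 / (1 + real R)"]) auto
      then have "4 * A / (1 + real R) ^ p * (1 / (1 + real R) - 1 / (1 + real (R + n))) \<le> 4 * A / (1 + real R) ^ p * 1"
        using A0 by (intro mult_left_mono) auto
      with telescope[of n y] show ?thesis by simp
    qed
    ultimately show ?thesis by (intro LIMSEQ_le_const2) auto
  qed
  \<comment> \<open>The error is continuous in the point, so the interior estimate extends to the
    end points.\<close>
  have "continuous_on S (G 0)" for S
    using d[THEN has_vector_derivative_continuous] by (simp add: continuous_at_imp_continuous_on)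
  then have "continuous_on (closure {a-pi<..<a+pi}) (\<lambda>y. norm (G 0 y - fourier_sum a R (G 0) y))"
    unfolding fourier_sum_def by (intro continuous_intros)
  then show ?thesis
    using continuous_le_on_closure[of "{a-pi<..<a+pi}" _ x "4 * A / (1 + real R) ^ p"] interior x
    by (auto simp: closure_greaterThanLessThan)
qed

section \<open>Fourier approximation in several variables\<close>

lemma compact_supp_subset: "compact K \<Longrightarrow> supp f \<subseteq> K \<Longrightarrow> compact (supp f)"
  by (metis closed_closure closed_Int_compact inf.absorb_iff1 supp_def)

lemma bounded_iter_partial:
  assumes "smooth \<psi>" "compact (supp \<psi>)"
  obtains A where "\<And>x. norm (iter_partial ds \<psi> x) \<le> A" "0 \<le> A"
proof -
  have "compact (iter_partial ds \<psi> ` supp \<psi>)"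
    by (intro compact_continuous_image smooth_continuous_on smooth_iter_partial assms)
  then obtain A where A: "\<And>x. x \<in> supp \<psi> \<Longrightarrow> norm (iter_partial ds \<psi> x) \<le> A"
    by (meson bounded_iff compact_imp_bounded imageI)
  have "norm (iter_partial ds \<psi> x) \<le> max A 0" for x
  proof (cases "x \<in> supp \<psi>")
    case False
    then have "iter_partial ds \<psi> x = 0" using supp_iter_partial[of ds \<psi>] by (intro not_in_supp) blast
    then show ?thesis by simp
  qed (use A[of x] in simp)
  then show thesis using that[of "max A 0"] by simp
qed

section \<open>Fourier coefficients along one coordinate\<close>

definition coord_update :: "real^'n \<Rightarrow> 'n \<Rightarrow> real \<Rightarrow> real^'n" where
  "coord_update x i t = (\<chi> j. if j = i then t else x $ j)"

lemma coord_update_nth [simp]: "coord_update x i t $ j = (if j = i then t else x $ j)"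
  by (simp add: coord_update_def)

lemma coord_update_same [simp]: "coord_update x i (x $ i) = x"
  by (simp add: vec_eq_iff)

lemma coord_update_swap: "i \<noteq> j \<Longrightarrow> coord_update (coord_update x i t) j s = coord_update (coord_update x j s) i t"
  by (auto simp: vec_eq_iff)

lemma continuous_on_coord_update [continuous_intros]:
  assumes "continuous_on S g" "continuous_on S h"
  shows "continuous_on S (\<lambda>z. coord_update (g z) i (h z))"
  unfolding coord_update_def
proof (rule continuous_on_vec_lambda)
  show "continuous_on S (\<lambda>z. if j = i then h z else g z $ j)" for j
    by (cases "j = i") (auto intro: assms continuous_on_component)
qed

lemma coord_update_has_vector_derivative:
  assumes "smooth f"
  shows "((\<lambda>t. f (coord_update x i t)) has_vector_derivative partial_deriv i f (coord_update x i t)) (at t)"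
proof -
  have "coord_update x i = (\<lambda>t. coord_update x i 0 + t *\<^sub>R axis i 1)"
    by (auto simp: vec_eq_iff axis_def)
  moreover have "((\<lambda>t. coord_update x i 0 + t *\<^sub>R axis i 1) has_derivative (\<lambda>h. h *\<^sub>R axis i 1)) (at t)"
    by (auto intro!: derivative_eq_intros)
  ultimately have "(coord_update x i has_derivative (\<lambda>h. h *\<^sub>R axis i 1)) (at t)"
    by metis
  from has_derivative_compose[OF this smooth_has_derivative[OF assms]]
  have "((\<lambda>t. f (coord_update x i t)) has_derivative
     (\<lambda>h. frechet_derivative f (at (coord_update x i t)) (h *\<^sub>R axis i 1))) (at t)" .
  moreover have "linear (frechet_derivative f (at (coord_update x i t)))"
    using smooth_has_derivative[OF assms] has_derivative_linear by blast
  ultimately show ?thesis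
    by (simp add: has_vector_derivative_def partial_deriv_def linear_cmul)
qed

text \<open>The result remains a function of the whole point, constant in its i-th coordinate, so
  that coefficients in different coordinates can be composed and interchanged.\<close>

definition partial_coeff :: "real^'n \<Rightarrow> 'n \<Rightarrow> int \<Rightarrow> (real^'n \<Rightarrow> complex) \<Rightarrow> real^'n \<Rightarrow> complex" where
  "partial_coeff a i m f x = fourier_coeff (a $ i) m (\<lambda>t. f (coord_update x i t))"

lemma continuous_on_slice:
  "continuous_on UNIV f \<Longrightarrow> continuous_on S (\<lambda>t. f (coord_update x i t))"
  by (rule continuous_on_compose2[of UNIV f]) (auto intro!: continuous_intros)

lemma continuous_on_partial_coeff:
  assumes "continuous_on UNIV f"
  shows "continuous_on UNIV (partial_coeff a i m f)"
proof -
  have "continuous_on (UNIV \<times> cbox (a$i - pi) (a$i + pi))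
      (\<lambda>z. f (coord_update (fst z) i (snd z)))"
    by (rule continuous_on_compose2[OF assms]) (auto intro!: continuous_intros)
  then have "continuous_on (UNIV \<times> cbox (a$i - pi) (a$i + pi))
      (\<lambda>(x, t). cis (- (of_int m * t)) * f (coord_update x i t))"
    unfolding case_prod_beta by (intro continuous_intros)
  from integral_continuous_on_param[OF this] show ?thesis
    unfolding partial_coeff_def fourier_coeff_def
    by (auto intro!: continuous_intros simp: partial_coeff_def fourier_coeff_def)
qed

text \<open>Fubini for continuous functions on the rectangle of the two coordinates.\<close>

lemma partial_coeff_commute:
  assumes f: "continuous_on UNIV f" and ij: "i \<noteq> j"
  shows "partial_coeff a i m (partial_coeff a j l f) = partial_coeff a j l (partial_coeff a i m f)"
proof
  fix x
  define F where "F t s = cis (- (of_int m * t)) * (cis (- (of_int l * s)) * f (coord_update (coord_update x i t) j s))" for t s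
  have "continuous_on (cbox (a$i - pi, a$j - pi) (a$i + pi, a$j + pi))
      (\<lambda>z. f (coord_update (coord_update x i (fst z)) j (snd z)))"
    by (rule continuous_on_compose2[OF f]) (auto intro!: continuous_intros)
  then have "continuous_on (cbox (a$i - pi, a$j - pi) (a$i + pi, a$j + pi)) (\<lambda>(t, s). F t s)"
    unfolding case_prod_beta F_def by (intro continuous_intros)
  from integral_swap_continuous[OF this]
  have swap: "integral {a$i - pi..a$i + pi} (\<lambda>t. integral {a$j - pi..a$j + pi} (F t)) =
      integral {a$j - pi..a$j + pi} (\<lambda>s. integral {a$i - pi..a$i + pi} (\<lambda>t. F t s))"
    by simp
  have "partial_coeff a i m (partial_coeff a j l f) x =
      integral {a$i - pi..a$i + pi} (\<lambda>t. integral {a$j - pi..a$j + pi} (F t)) / of_real (2 * pi) / of_real (2 * pi)"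
    by (simp add: partial_coeff_def fourier_coeff_def F_def[abs_def])
  moreover have "partial_coeff a j l (partial_coeff a i m f) x =
      integral {a$j - pi..a$j + pi} (\<lambda>s. integral {a$i - pi..a$i + pi} (\<lambda>t. F t s)) / of_real (2 * pi) / of_real (2 * pi)"
    using ij by (simp add: partial_coeff_def fourier_coeff_def F_def[abs_def] coord_update_swap[of j i]
        mult.left_commute[of "cis (- (of_int m * _))"])
  ultimately show "partial_coeff a i m (partial_coeff a j l f) x = partial_coeff a j l (partial_coeff a i m f) x"
    using swap by simp
qed

lemma partial_coeff_scale: "partial_coeff a i m (\<lambda>x. c * f x) = (\<lambda>x. c * partial_coeff a i m f x)"
  by (simp add: partial_coeff_def fourier_coeff_def mult.left_commute[of _ c] fun_eq_iff)

lemma norm_partial_coeff_le: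
  assumes "continuous_on UNIV f" "\<And>x. norm (f x) \<le> A"
  shows "norm (partial_coeff a i m f x) \<le> A"
  unfolding partial_coeff_def by (intro norm_fourier_coeff_le continuous_on_slice assms)

definition closed_box :: "real^'n \<Rightarrow> (real^'n) set" where
  "closed_box a = {x. \<forall>i. \<bar>x $ i - a $ i\<bar> \<le> pi}"

definition open_box :: "real^'n \<Rightarrow> (real^'n) set" where
  "open_box a = {x. \<forall>i. \<bar>x $ i - a $ i\<bar> < pi}"

lemma coord_update_closed_box:
  "x \<in> closed_box a \<Longrightarrow> t \<in> {a$i - pi..a$i + pi} \<Longrightarrow> coord_update x i t \<in> closed_box a"
  by (auto simp: closed_box_def)

text \<open>Supplies the equal end values that integration by parts asks for: the faces lie outside
  the open box.\<close>

lemma zero_at_box_faces: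
  assumes "supp \<psi> \<subseteq> open_box a"
  shows "\<psi> (coord_update x i (a$i - pi)) = 0" "\<psi> (coord_update x i (a$i + pi)) = 0"
proof -
  have "coord_update x i (a$i - pi) \<notin> open_box a" "coord_update x i (a$i + pi) \<notin> open_box a"
    by (auto simp: open_box_def intro!: exI[of _ i])
  then show "\<psi> (coord_update x i (a$i - pi)) = 0" "\<psi> (coord_update x i (a$i + pi)) = 0"
    using assms not_in_supp by blast+
qed

lemma partial_coeff_deriv:
  assumes "smooth \<psi>" "supp \<psi> \<subseteq> open_box a"
  shows "partial_coeff a i m (partial_deriv i \<psi>) = (\<lambda>x. \<i> * of_int m * partial_coeff a i m \<psi> x)"
proof
  show "partial_coeff a i m (partial_deriv i \<psi>) x = \<i> * of_int m * partial_coeff a i m \<psi> x" for x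
    unfolding partial_coeff_def
    by (rule fourier_coeff_deriv)
      (auto intro!: has_vector_derivative_at_within coord_update_has_vector_derivative continuous_on_slice
         smooth_continuous_on smooth_partial_deriv assms simp: zero_at_box_faces[OF assms(2)])
qed

section \<open>Iterated Fourier coefficients\<close>

primrec iter_coeff :: "real^'n \<Rightarrow> 'n list \<Rightarrow> ('n \<Rightarrow> int) \<Rightarrow> (real^'n \<Rightarrow> complex) \<Rightarrow> real^'n \<Rightarrow> complex" where
  "iter_coeff a [] m f = f"
| "iter_coeff a (i # idx) m f = partial_coeff a i (m i) (iter_coeff a idx m f)"

lemma continuous_on_iter_coeff: "continuous_on UNIV f \<Longrightarrow> continuous_on UNIV (iter_coeff a idx m f)"
  by (induction idx) (auto intro: continuous_on_partial_coeff)

lemma norm_iter_coeff_le: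
  assumes "continuous_on UNIV f" "\<And>x. norm (f x) \<le> A"
  shows "norm (iter_coeff a idx m f x) \<le> A"
  by (induction idx arbitrary: x) (auto intro!: norm_partial_coeff_le continuous_on_iter_coeff assms)

lemma iter_coeff_scale: "iter_coeff a idx m (\<lambda>x. c * f x) = (\<lambda>x. c * iter_coeff a idx m f x)"
  by (induction idx) (simp_all add: partial_coeff_scale)

lemma iter_coeff_cong: "(\<And>i. i \<in> set idx \<Longrightarrow> m i = m' i) \<Longrightarrow> iter_coeff a idx m f = iter_coeff a idx m' f"
  by (induction idx) auto

text \<open>Each integration removes the dependence on its own coordinate; once all coordinates are
  listed, the coefficient is a constant.\<close>

lemma iter_coeff_eq:
  assumes "\<And>i. i \<notin> set idx \<Longrightarrow> x $ i = y $ i"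
  shows "iter_coeff a idx m f x = iter_coeff a idx m f y"
  using assms
proof (induction idx arbitrary: x y)
  case Nil
  then have "x = y" by (simp add: vec_eq_iff)
  then show ?case by simp
next
  case (Cons i idx)
  have "iter_coeff a idx m f (coord_update x i t) = iter_coeff a idx m f (coord_update y i t)" for t
    using Cons.prems by (intro Cons.IH) auto
  then show ?case by (simp add: partial_coeff_def)
qed

lemma iter_coeff_partial_coeff:
  assumes "continuous_on UNIV f" "i \<notin> set idx"
  shows "partial_coeff a i l (iter_coeff a idx m f) = iter_coeff a idx m (partial_coeff a i l f)"
  using assms(2)
proof (induction idx)
  case (Cons j idx)
  then show ?case
    using partial_coeff_commute[OF continuous_on_iter_coeff[OF assms(1), of a idx m], of i j a l "m j"] by simp
qed simp

lemma iter_coeff_deriv: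
  assumes \<psi>: "smooth \<psi>" "supp \<psi> \<subseteq> open_box a" and i: "i \<in> set idx" "distinct idx"
  shows "iter_coeff a idx m (partial_deriv i \<psi>) = (\<lambda>x. \<i> * of_int (m i) * iter_coeff a idx m \<psi> x)"
  using i
proof (induction idx)
  case (Cons j idx)
  show ?case
  proof (cases "i = j")
    case True
    then have i: "i \<notin> set idx" using Cons.prems by auto
    \<comment> \<open>The coefficient in direction i is moved innermost, where integration by parts
      meets \<psi> itself, whose support in the open box makes the boundary terms vanish.\<close>
    have "iter_coeff a (i # idx) m (partial_deriv i \<psi>) = iter_coeff a idx m (partial_coeff a i (m i) (partial_deriv i \<psi>))"
      using i by (simp add: iter_coeff_partial_coeff smooth_continuous_on smooth_partial_deriv \<psi>)
    also have "\<dots> = (\<lambda>x. \<i> * of_int (m i) * iter_coeff a idx m (partial_coeff a i (m i) \<psi>) x)"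
      by (simp add: partial_coeff_deriv \<psi> iter_coeff_scale)
    also have "iter_coeff a idx m (partial_coeff a i (m i) \<psi>) = iter_coeff a (i # idx) m \<psi>"
      using i by (simp add: iter_coeff_partial_coeff smooth_continuous_on \<psi>)
    finally show ?thesis using True by simp
  next
    case False
    with Cons show ?thesis by (simp add: partial_coeff_scale)
  qed
qed simp

section \<open>Partial Fourier sums in several variables\<close>

definition box_indices :: "'n set \<Rightarrow> nat \<Rightarrow> ('n \<Rightarrow> int) set" where
  "box_indices I R = PiE I (\<lambda>_. {- int R..int R})"

lemma finite_box_indices [simp]: "finite I \<Longrightarrow> finite (box_indices I R)"
  by (auto simp: box_indices_def intro: finite_PiE)

lemma box_indices_empty [simp]: "box_indices {} R = {\<lambda>_. undefined}"
  by (simp add: box_indices_def)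

text \<open>Only the coordinates in idx are expanded; the coefficients still depend on the other
  coordinates of x. These intermediate sums are the stages of the inductions on idx.\<close>

definition multi_sum :: "real^'n \<Rightarrow> 'n list \<Rightarrow> nat \<Rightarrow> (real^'n \<Rightarrow> complex) \<Rightarrow> real^'n \<Rightarrow> complex" where
  "multi_sum a idx R f x =
     (\<Sum>m\<in>box_indices (set idx) R. cis (\<Sum>i\<in>set idx. of_int (m i) * x $ i) * iter_coeff a idx m f x)"

lemma continuous_on_multi_sum: "continuous_on UNIV f \<Longrightarrow> continuous_on UNIV (multi_sum a idx R f)"
  unfolding multi_sum_def by (intro continuous_intros continuous_on_iter_coeff)

lemma fourier_coeff_linear_combination:
  assumes "finite M" "\<And>m. m \<in> M \<Longrightarrow> continuous_on {a-pi..a+pi} (h m)"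
  shows "fourier_coeff a l (\<lambda>t. \<Sum>m\<in>M. c m * h m t) = (\<Sum>m\<in>M. c m * fourier_coeff a l (h m))"
proof -
  have "integral {a-pi..a+pi} (\<lambda>t. cis (- (of_int l * t)) * (\<Sum>m\<in>M. c m * h m t)) =
     integral {a-pi..a+pi} (\<lambda>t. \<Sum>m\<in>M. c m * (cis (- (of_int l * t)) * h m t))"
    by (simp add: sum_distrib_left mult.left_commute)
  also have "\<dots> = (\<Sum>m\<in>M. integral {a-pi..a+pi} (\<lambda>t. c m * (cis (- (of_int l * t)) * h m t)))"
    using assms by (intro integral_sum integrable_on_mult_right fourier_coeff_integrable)
  finally show ?thesis by (simp add: fourier_coeff_def sum_divide_distrib)
qed

lemma multi_sum_Cons:
  assumes f: "continuous_on UNIV f" and d: "distinct (i # idx)"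
  shows "multi_sum a (i # idx) R f x = fourier_sum (a$i) R (\<lambda>t. multi_sum a idx R f (coord_update x i t)) (x$i)"
proof -
  define e where "e m = cis (\<Sum>j\<in>set idx. of_int (m j) * x $ j)" for m :: "'a \<Rightarrow> int"
  have i: "i \<notin> set idx" using d by simp
  have "(\<Sum>j\<in>set idx. of_int (m j) * coord_update x i t $ j) = (\<Sum>j\<in>set idx. of_int (m j) * x $ j)" for m t
    using i by (intro sum.cong) auto
  then have *: "(\<lambda>t. multi_sum a idx R f (coord_update x i t)) =
     (\<lambda>t. \<Sum>m\<in>box_indices (set idx) R. e m * iter_coeff a idx m f (coord_update x i t))"
    by (simp add: multi_sum_def e_def)
  have "fourier_sum (a$i) R (\<lambda>t. multi_sum a idx R f (coord_update x i t)) (x$i) =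
     (\<Sum>l\<in>{-int R..int R}. cis (of_int l * x$i) *
        (\<Sum>m\<in>box_indices (set idx) R. e m * partial_coeff a i l (iter_coeff a idx m f) x))"
    unfolding fourier_sum_def * partial_coeff_def
    by (subst fourier_coeff_linear_combination) (auto intro: continuous_on_slice continuous_on_iter_coeff f)
  also have "\<dots> = (\<Sum>(l, m)\<in>{-int R..int R} \<times> box_indices (set idx) R.
        cis (of_int l * x$i) * e m * partial_coeff a i l (iter_coeff a idx m f) x)"
    by (simp add: sum_distrib_left sum.cartesian_product mult.assoc)
  also have "\<dots> = (\<Sum>(l, m)\<in>{-int R..int R} \<times> box_indices (set idx) R.
        cis (\<Sum>j\<in>set (i # idx). of_int ((m(i := l)) j) * x $ j) * iter_coeff a (i # idx) (m(i := l)) f x)"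
  proof (intro sum.cong refl, clarify)
    fix l m
    have "(\<Sum>j\<in>set idx. of_int ((m(i := l)) j) * x $ j) = (\<Sum>j\<in>set idx. of_int (m j) * x $ j)"
      using i by (intro sum.cong) auto
    then have "cis (\<Sum>j\<in>set (i # idx). of_int ((m(i := l)) j) * x $ j) = cis (of_int l * x$i) * e m"
      using i by (simp add: e_def cis_mult)
    moreover have "iter_coeff a idx (m(i := l)) f = iter_coeff a idx m f"
      using i by (intro iter_coeff_cong) auto
    ultimately show "cis (of_int l * x$i) * e m * partial_coeff a i l (iter_coeff a idx m f) x =
        cis (\<Sum>j\<in>set (i # idx). of_int ((m(i := l)) j) * x $ j) * iter_coeff a (i # idx) (m(i := l)) f x"
      by simp
  qed
  \<comment> \<open>Every multi-index on \<open>set (i # idx)\<close> is \<open>m(i := l)\<close>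
    for exactly one pair, because \<open>PiE\<close> fixes the values outside the index set.\<close>
  also have "\<dots> = multi_sum a (i # idx) R f x"
    unfolding multi_sum_def box_indices_def list.set(2) PiE_insert_eq
    using inj_combinator[OF i, of "\<lambda>_. {-int R..int R}"]
    by (subst sum.reindex) (auto simp: case_prod_beta o_def)
  finally show ?thesis by simp
qed

text \<open>Writing \<open>f - S T f = (f - S f) + S (f - T f)\<close>, with \<open>S\<close> the partial sum in one coordinate,
  only ever applies the one-dimensional error estimate to \<open>f\<close> itself.\<close>

lemma multi_sum_error:
  assumes f: "continuous_on UNIV f" and d: "distinct idx" and e: "0 \<le> e"
    and err: "\<And>x i. x \<in> closed_box a \<Longrightarrow> norm (f x - fourier_sum (a$i) R (\<lambda>t. f (coord_update x i t)) (x$i)) \<le> e"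
    and x: "x \<in> closed_box a"
  shows "norm (f x - multi_sum a idx R f x) \<le> e * (2 * real R + 2) ^ length idx"
  using d x
proof (induction idx arbitrary: x)
  case Nil
  from e show ?case by (simp add: multi_sum_def)
next
  case (Cons i idx)
  let ?f = "\<lambda>t. f (coord_update x i t)" and ?g = "\<lambda>t. multi_sum a idx R f (coord_update x i t)"
  define E where "E = e * (2 * real R + 2) ^ length idx"
  have cf: "continuous_on S ?f" and cg: "continuous_on S ?g" for S
    by (intro continuous_on_slice continuous_on_multi_sum f)+
  \<comment> \<open>A coefficient is bounded by the supremum of its function, so each of the 2 R + 1
    coefficient errors is at most E; together with e \<le> E this gives the factor 2 R + 2.\<close>
  have "norm (fourier_coeff (a$i) l ?f - fourier_coeff (a$i) l ?g) \<le> E" for l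
  proof -
    have "fourier_coeff (a$i) l ?f - fourier_coeff (a$i) l ?g = fourier_coeff (a$i) l (\<lambda>t. ?f t - ?g t)"
      unfolding fourier_coeff_def diff_divide_distrib[symmetric] right_diff_distrib
      by (subst integral_diff) (auto intro!: fourier_coeff_integrable cf cg)
    also have "norm \<dots> \<le> E"
      unfolding E_def using Cons.prems
      by (intro norm_fourier_coeff_le continuous_intros cf cg Cons.IH coord_update_closed_box) auto
    finally show ?thesis .
  qed
  then have "norm (\<Sum>l\<in>{-int R..int R}. cis (of_int l * x$i) * (fourier_coeff (a$i) l ?f - fourier_coeff (a$i) l ?g))
     \<le> (\<Sum>l\<in>{-int R..int R}. E)"
    by (intro sum_norm_le) (simp add: norm_mult)
  then have 1: "norm (fourier_sum (a$i) R ?f (x$i) - fourier_sum (a$i) R ?g (x$i)) \<le> (2 * real R + 1) * E"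
    by (simp add: fourier_sum_def sum_subtractf right_diff_distrib algebra_simps)
  have "1 \<le> (2 * real R + 2) ^ length idx" by (rule one_le_power) simp
  then have "e \<le> E" unfolding E_def using e mult_left_mono[of 1 _ e] by simp
  have "f x - multi_sum a (i # idx) R f x = (f x - fourier_sum (a$i) R ?f (x$i)) +
      (fourier_sum (a$i) R ?f (x$i) - fourier_sum (a$i) R ?g (x$i))"
    by (simp add: multi_sum_Cons[OF f Cons.prems(1)])
  also have "norm \<dots> \<le> e + (2 * real R + 1) * E"
    by (intro norm_triangle_mono err 1 Cons.prems)
  also have "\<dots> \<le> (2 * real R + 2) * E" using \<open>e \<le> E\<close> by (simp add: algebra_simps)
  finally show ?case by (simp add: E_def mult_ac)
qed

lemma smooth_fourier_sum_error:
  assumes \<psi>: "smooth \<psi>" "supp \<psi> \<subseteq> open_box a"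
    and A: "\<And>x. norm (iter_partial (replicate (p + 2) i) \<psi> x) \<le> A" and x: "x \<in> closed_box a"
  shows "norm (\<psi> x - fourier_sum (a$i) R (\<lambda>t. \<psi> (coord_update x i t)) (x$i)) \<le> 4 * A / (1 + real R) ^ p"
proof -
  define G where "G l t = iter_partial (replicate l i) \<psi> (coord_update x i t)" for l t
  have "norm (G 0 (x$i) - fourier_sum (a$i) R (G 0) (x$i)) \<le> 4 * A / (1 + real R) ^ p"
  proof (rule fourier_sum_error)
    show "(G l has_vector_derivative G (Suc l) t) (at t)" for l t
      unfolding G_def replicate_Suc iter_partial.simps
      by (intro coord_update_has_vector_derivative smooth_iter_partial \<psi>)
    have "supp (iter_partial (replicate l i) \<psi>) \<subseteq> open_box a" for l
      using supp_iter_partial \<psi>(2) by blast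
    from zero_at_box_faces[OF this] show "G l (a$i - pi) = G l (a$i + pi)" for l
      by (simp add: G_def)
    show "norm (G (p + 2) t) \<le> A" for t unfolding G_def by (rule A)
    show "x$i \<in> {a$i - pi..a$i + pi}"
      using x by (auto simp: closed_box_def abs_le_iff algebra_simps dest: spec[of _ i])
  qed
  moreover have "G 0 = (\<lambda>t. \<psi> (coord_update x i t))" by (simp add: G_def fun_eq_iff)
  ultimately show ?thesis by simp
qed

text \<open>Each coordinate costs a factor 2 R + 2. Using the one-variable estimate with rate q + n,
  where n is the number of coordinates, pays for all of them in advance.\<close>

lemma smooth_multi_sum_error:
  assumes \<psi>: "smooth \<psi>" "compact (supp \<psi>)" "supp \<psi> \<subseteq> open_box a" and d: "distinct idx"
  shows "\<exists>C. \<forall>R. \<forall>x\<in>closed_box a. norm (\<psi> x - multi_sum a idx R \<psi> x) \<le> C / (1 + real R) ^ q"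
proof -
  define n where "n = length idx"
  have "\<forall>i. \<exists>A. 0 \<le> A \<and> (\<forall>x. norm (iter_partial (replicate (q + n + 2) i) \<psi> x) \<le> A)"
    using bounded_iter_partial[OF \<psi>(1,2)] by metis
  then obtain A where A: "\<And>i. 0 \<le> A i" "\<And>i x. norm (iter_partial (replicate (q + n + 2) i) \<psi> x) \<le> A i"
    by metis
  define B where "B = sum A UNIV"
  have B: "norm (iter_partial (replicate (q + n + 2) i) \<psi> x) \<le> B" for i x
    using A(2)[of i x] member_le_sum[of i UNIV A] A(1) by (simp add: B_def)
  have "norm (\<psi> x - multi_sum a idx R \<psi> x) \<le> 4 * B * 2 ^ n / (1 + real R) ^ q" if x: "x \<in> closed_box a" for x R
  proof -
    have "0 \<le> 4 * B / (1 + real R) ^ (q + n)" using A(1) by (simp add: B_def sum_nonneg)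
    then have "norm (\<psi> x - multi_sum a idx R \<psi> x) \<le> 4 * B / (1 + real R) ^ (q + n) * (2 * real R + 2) ^ n"
      unfolding n_def
      by (intro multi_sum_error smooth_continuous_on \<psi> d x smooth_fourier_sum_error B[unfolded n_def]) auto
    also have "(2 * real R + 2) ^ n = 2 ^ n * (1 + real R) ^ n"
      by (simp add: power_mult_distrib[symmetric] algebra_simps)
    also have "4 * B / (1 + real R) ^ (q + n) * (2 ^ n * (1 + real R) ^ n) = 4 * B * 2 ^ n / (1 + real R) ^ q"
      by (simp add: power_add)
    finally show ?thesis .
  qed
  then show ?thesis by blast
qed

definition freq :: "('n \<Rightarrow> int) \<Rightarrow> real^'n" where
  "freq m = (\<chi> i. of_int (m i))"

lemma cis_freq: "cis (\<Sum>i\<in>UNIV. of_int (m i) * x $ i) = character (- freq m) x"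
  by (simp add: character_def cis_conv_exp freq_def inner_vec_def sum_negf)

text \<open>The coefficients of a derivative are those of the function times i m_j, so the
  derivative of the truncation error is the truncation error of the derivative. One family c thus
  serves all derivatives and all R.\<close>

lemma fourier_approximation:
  fixes \<psi> :: "real^'n \<Rightarrow> complex"
  assumes \<psi>: "smooth \<psi>" "compact (supp \<psi>)" "supp \<psi> \<subseteq> open_box a"
  obtains c A where "\<And>m. norm (c m) \<le> A"
    "\<And>ds q. \<exists>C. \<forall>R. \<forall>x\<in>closed_box a.
       norm (iter_partial ds (\<lambda>x. \<psi> x - (\<Sum>m\<in>box_indices UNIV R. c m * character (- freq m) x)) x) \<le> C / (1 + real R) ^ q"
proof -
  obtain idx :: "'n list" where idx: "distinct idx" "set idx = UNIV"
    using finite_distinct_list[of "UNIV :: 'n set"] by auto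
  \<comment> \<open>The evaluation point a is an arbitrary choice, the full coefficient being
    constant.\<close>
  define c where "c f m = iter_coeff a idx m f a" for f m
  have c: "iter_coeff a idx m f x = c f m" for f m x
    unfolding c_def by (rule iter_coeff_eq) (simp add: idx)
  have T: "multi_sum a idx R f = (\<lambda>x. \<Sum>m\<in>box_indices UNIV R. c f m * character (- freq m) x)" for R f
    unfolding multi_sum_def idx(2) c cis_freq by (simp add: mult.commute)
  have deriv: "iter_partial ds (\<lambda>x. \<psi> x - multi_sum a idx R \<psi> x) =
      (\<lambda>x. iter_partial ds \<psi> x - multi_sum a idx R (iter_partial ds \<psi>) x)" for ds R
  proof (induction ds)
    case (Cons i ds)
    define f where "f = iter_partial ds \<psi>"
    have f: "smooth f" "supp f \<subseteq> open_box a"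
      using \<psi> supp_iter_partial[of ds \<psi>] by (auto simp: f_def smooth_iter_partial)
    have "((\<lambda>x. f x - (\<Sum>m\<in>box_indices UNIV R. c f m * character (- freq m) x)) has_derivative
       (\<lambda>h. frechet_derivative f (at x) h -
         (\<Sum>m\<in>box_indices UNIV R. - \<i> * of_real (- freq m \<bullet> h) * (c f m * character (- freq m) x)))) (at x)" for x
      by (intro has_derivative_diff smooth_has_derivative f has_derivative_sum character_has_derivative)
    from partial_deriv_eqI[OF this]
    have "partial_deriv i (\<lambda>x. f x - (\<Sum>m\<in>box_indices UNIV R. c f m * character (- freq m) x)) x =
       partial_deriv i f x - (\<Sum>m\<in>box_indices UNIV R. \<i> * of_int (m i) * c f m * character (- freq m) x)" for x
      by (simp add: partial_deriv_def inner_axis freq_def mult.assoc)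
    moreover have "c (partial_deriv i f) m = \<i> * of_int (m i) * c f m" for m
      using iter_coeff_deriv[OF f, of i idx m] idx by (simp add: c_def)
    ultimately have "partial_deriv i (\<lambda>x. f x - multi_sum a idx R f x) =
       (\<lambda>x. partial_deriv i f x - multi_sum a idx R (partial_deriv i f) x)"
      by (simp add: T fun_eq_iff)
    with Cons show ?case by (simp add: f_def)
  qed simp
  obtain A where A: "\<And>x. norm (\<psi> x) \<le> A"
    using bounded_iter_partial[OF \<psi>(1,2), of "[]"] by auto
  show thesis
  proof (rule that)
    show "norm (c \<psi> m) \<le> A" for m
      unfolding c_def by (intro norm_iter_coeff_le smooth_continuous_on \<psi> A)
    fix ds q
    have "smooth (iter_partial ds \<psi>)" "supp (iter_partial ds \<psi>) \<subseteq> open_box a" "compact (supp (iter_partial ds \<psi>))"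
      using \<psi> supp_iter_partial[of ds \<psi>] by (auto simp: smooth_iter_partial intro: compact_supp_subset)
    note error = smooth_multi_sum_error[OF this(1,3,2) idx(1), of q]
    have "iter_partial ds (\<lambda>x. \<psi> x - (\<Sum>m\<in>box_indices UNIV R. c \<psi> m * character (- freq m) x)) =
      (\<lambda>x. iter_partial ds \<psi> x - multi_sum a idx R (iter_partial ds \<psi>) x)" for R
      using deriv[of ds R] by (simp only: T)
    with error
    show "\<exists>C. \<forall>R. \<forall>x\<in>closed_box a. norm (iter_partial ds (\<lambda>x. \<psi> x -
       (\<Sum>m\<in>box_indices UNIV R. c \<psi> m * character (- freq m) x)) x) \<le> C / (1 + real R) ^ q"
      by simp
  qed
qed

section \<open>Bump functions\<close>

text \<open>The recursion is the derivative of p(1/t) exp(-1/t), namely t^-2 (p - p')(1/t)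
  exp(-1/t), written as a polynomial in 1/t.\<close>

primrec flat_poly :: "nat \<Rightarrow> real poly" where
  "flat_poly 0 = 1"
| "flat_poly (Suc m) = [:0, 0, 1:] * (flat_poly m - pderiv (flat_poly m))"

text \<open>\<open>flat m\<close> is the \<open>m\<close>-th derivative of the smooth function \<open>exp (- 1 / t)\<close>, extended by 0.\<close>

definition flat :: "nat \<Rightarrow> real \<Rightarrow> real" where
  "flat m t = (if 0 < t then poly (flat_poly m) (1 / t) * exp (- (1 / t)) else 0)"

lemma poly_times_exp_tendsto_zero: "((\<lambda>y :: real. poly p y * exp (- y)) \<longlongrightarrow> 0) at_top"
proof -
  have "((\<lambda>y :: real. \<Sum>i\<le>degree p. coeff p i * (y ^ i / exp y)) \<longlongrightarrow> (\<Sum>i\<le>degree p. coeff p i * 0)) at_top"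
    by (intro tendsto_intros tendsto_power_div_exp_0)
  moreover have "(\<lambda>y :: real. \<Sum>i\<le>degree p. coeff p i * (y ^ i / exp y)) = (\<lambda>y. poly p y * exp (- y))"
    by (simp add: poly_altdef sum_distrib_left exp_minus divide_inverse mult_ac fun_eq_iff)
  ultimately show ?thesis by simp
qed

lemma flat_has_derivative: "(flat m has_real_derivative flat (Suc m) t) (at t)"
proof (cases t "0 :: real" rule: linorder_cases)
  case less
  have "((\<lambda>t. 0) has_real_derivative flat (Suc m) t) (at t)" using less by (simp add: flat_def)
  then show ?thesis
    by (rule has_field_derivative_transform_within_open[where S="{..<0}"]) (use less in \<open>auto simp: flat_def\<close>)
next
  case greater
  have "((\<lambda>t. poly (flat_poly m) (1 / t) * exp (- (1 / t))) has_real_derivative flat (Suc m) t) (at t)"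
    using greater
    by (auto intro!: derivative_eq_intros simp: flat_def field_simps power2_eq_square)
  then show ?thesis
    by (rule has_field_derivative_transform_within_open[where S="{0<..}"]) (use greater in \<open>auto simp: flat_def\<close>)
next
  case equal
  \<comment> \<open>Right of 0 the difference quotient is (1/h) p(1/h) exp(-1/h);
    \<open>pCons 0\<close> supplies the factor 1/h.\<close>
  have "((\<lambda>h. poly (pCons 0 (flat_poly m)) (inverse h) * exp (- inverse h)) \<longlongrightarrow> 0) (at_right 0)"
    by (rule filterlim_compose[OF poly_times_exp_tendsto_zero filterlim_inverse_at_top_right])
  moreover have "eventually (\<lambda>h. poly (pCons 0 (flat_poly m)) (inverse h) * exp (- inverse h) = (flat m h - flat m 0) / (h - 0)) (at_right 0)"
    by (auto simp: eventually_at_filter flat_def field_simps)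
  ultimately have "((\<lambda>h. (flat m h - flat m 0) / (h - 0)) \<longlongrightarrow> 0) (at_right 0)"
    by (rule Lim_transform_eventually)
  moreover have "((\<lambda>h. (flat m h - flat m 0) / (h - 0)) \<longlongrightarrow> 0) (at_left 0)"
    by (rule tendsto_eventually) (auto simp: eventually_at_filter flat_def)
  ultimately have "((\<lambda>h. (flat m h - flat m 0) / (h - 0)) \<longlongrightarrow> 0) (at 0)"
    using filterlim_split_at by blast
  then show ?thesis using equal by (simp add: has_field_derivative_iff flat_def)
qed

lemma flat_zero_mono: "s \<le> t \<Longrightarrow> flat 0 s \<le> flat 0 t"
  by (auto simp: flat_def frac_le)

lemma flat_pos: "0 < t \<Longrightarrow> 0 < flat 0 t"
  by (simp add: flat_def)

lemma flat_nonpos: "t \<le> 0 \<Longrightarrow> flat m t = 0"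
  by (simp add: flat_def)

text \<open>The inner function is constantly \<open>flat 0 3\<close> for \<open>dist q x \<le> r\<close> and nonpositive for
  \<open>dist q x \<ge> 2 * r\<close>, which makes the outer one flat on both regions without a quotient of
  nonconstant functions.\<close>

definition bump :: "real^'n \<Rightarrow> real \<Rightarrow> real^'n \<Rightarrow> complex" where
  "bump q r x = of_real (flat 0 (flat 0 3 - flat 0 ((dist q x / r)\<^sup>2 - 1))) / of_real (flat 0 (flat 0 3))"

lemma smooth_bump: "smooth (bump q r)"
proof -
  \<comment> \<open>The squared distance is a polynomial in the coordinates, hence smooth at q too,
    unlike the distance.\<close>
  have "smooth (\<lambda>x. (\<Sum>j\<in>UNIV. (complex_of_real (x $ j) - of_real (q $ j)) * (complex_of_real (x $ j) - of_real (q $ j))) * of_real (1 / r\<^sup>2) - 1)"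
    by (intro smooth_diff smooth_mult smooth_sum smooth_coordinate smooth_const)
  also have "(\<lambda>x. (\<Sum>j\<in>UNIV. (complex_of_real (x $ j) - of_real (q $ j)) * (complex_of_real (x $ j) - of_real (q $ j))) * of_real (1 / r\<^sup>2) - 1)
     = (\<lambda>x. complex_of_real ((dist q x / r)\<^sup>2 - 1))"
  proof
    fix x
    have "(dist q x)\<^sup>2 = (\<Sum>j\<in>UNIV. (x $ j - q $ j) * (x $ j - q $ j))"
      unfolding dist_commute[of q x] by (simp add: dist_norm power2_norm_eq_inner inner_vec_def)
    then have "complex_of_real ((dist q x)\<^sup>2) = (\<Sum>j\<in>UNIV. (complex_of_real (x $ j) - of_real (q $ j)) * (complex_of_real (x $ j) - of_real (q $ j)))"
      by simp
    then show "(\<Sum>j\<in>UNIV. (complex_of_real (x $ j) - of_real (q $ j)) * (complex_of_real (x $ j) - of_real (q $ j))) * of_real (1 / r\<^sup>2) - 1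
       = complex_of_real ((dist q x / r)\<^sup>2 - 1)"
      by (simp add: power_divide)
  qed
  finally have "smooth (\<lambda>x. complex_of_real ((dist q x / r)\<^sup>2 - 1))" .
  from smooth_diff[OF smooth_const[of "of_real (flat 0 3)"] smooth_compose[where G=flat and m=0, OF flat_has_derivative this]]
  have "smooth (\<lambda>x. complex_of_real (flat 0 3 - flat 0 ((dist q x / r)\<^sup>2 - 1)))" by simp
  from smooth_mult[OF smooth_compose[where G=flat and m=0, OF flat_has_derivative this] smooth_const[of "1 / of_real (flat 0 (flat 0 3))"]]
  show ?thesis by (simp add: bump_def[abs_def])
qed

lemma bump_eq_1:
  assumes "dist q x \<le> r" "0 < r"
  shows "bump q r x = 1"
proof -
  have "(dist q x / r)\<^sup>2 \<le> 1" using assms by (simp add: power_le_one)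
  moreover have "flat 0 (flat 0 3) \<noteq> 0" using flat_pos[of "flat 0 3"] flat_pos[of 3] by simp
  ultimately show ?thesis by (simp add: bump_def flat_nonpos)
qed

lemma bump_eq_0:
  assumes "2 * r \<le> dist q x" "0 < r"
  shows "bump q r x = 0"
proof -
  have "2 \<le> dist q x / r" using assms by (simp add: pos_le_divide_eq)
  then have "2\<^sup>2 \<le> (dist q x / r)\<^sup>2" by (intro power_mono) auto
  \<comment> \<open>The constant 3 in \<open>bump\<close> is 2^2 - 1, the inner argument at distance
    2 r.\<close>
  then have "flat 0 3 \<le> flat 0 ((dist q x / r)\<^sup>2 - 1)" by (intro flat_zero_mono) simp
  then show ?thesis by (simp add: bump_def flat_nonpos)
qed

lemma supp_bump: "0 < r \<Longrightarrow> supp (bump q r) \<subseteq> cball q (2 * r)"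
  by (rule supp_subsetI) (auto intro: bump_eq_0)

lemma coord_dist_le: "\<bar>x $ i - a $ i\<bar> \<le> dist a x"
  using component_le_norm_cart[of "x - a" i] by (simp add: dist_norm norm_minus_commute)

lemma cball_subset_closed_box: "\<rho> \<le> pi \<Longrightarrow> cball a \<rho> \<subseteq> closed_box a"
  by (auto simp: closed_box_def intro: order_trans[OF coord_dist_le])

lemma cball_subset_open_box: "\<rho> < pi \<Longrightarrow> cball a \<rho> \<subseteq> open_box a"
  by (auto simp: open_box_def intro: order.strict_trans1[OF coord_dist_le])

section \<open>Localization of the microlocal seminorms\<close>

text \<open>The algebraic part of being a distribution: differences \<open>v - u\<close> have it at
  once, and it suffices for splitting finite sums.\<close>

definition test_linear :: "(real^'n) set \<Rightarrow> ((real^'n \<Rightarrow> complex) \<Rightarrow> complex) \<Rightarrow> bool" where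
  "test_linear \<Omega> w \<longleftrightarrow>
     (\<forall>\<phi>\<in>test_functions \<Omega>. \<forall>\<psi>\<in>test_functions \<Omega>. w (\<lambda>x. \<phi> x + \<psi> x) = w \<phi> + w \<psi>) \<and>
     (\<forall>c. \<forall>\<phi>\<in>test_functions \<Omega>. w (\<lambda>x. c * \<phi> x) = c * w \<phi>)"

lemma test_linear_diff: "u \<in> distributions \<Omega> \<Longrightarrow> v \<in> distributions \<Omega> \<Longrightarrow> test_linear \<Omega> (v - u)"
  by (auto simp: test_linear_def distributions_def algebra_simps)

lemma closed_supp: "closed (supp f)"
  by (simp add: supp_def)

lemma test_functionsI: "smooth f \<Longrightarrow> compact K \<Longrightarrow> supp f \<subseteq> K \<Longrightarrow> K \<subseteq> \<Omega> \<Longrightarrow> f \<in> test_functions \<Omega>"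
  by (auto simp: test_functions_def intro: compact_supp_subset)

lemma test_functions_mult:
  assumes "\<theta> \<in> test_functions \<Omega>" "smooth g"
  shows "(\<lambda>x. \<theta> x * g x) \<in> test_functions \<Omega>"
  using assms supp_mult[of \<theta> g]
  by (auto simp: test_functions_def intro: smooth_mult compact_supp_subset)

lemma test_functions_scale:
  assumes "\<theta> \<in> test_functions \<Omega>"
  shows "(\<lambda>x. c * \<theta> x) \<in> test_functions \<Omega>"
  using test_functions_mult[OF assms smooth_const[of c]] by (simp add: mult.commute)

lemma test_functions_add:
  assumes "\<phi> \<in> test_functions \<Omega>" "\<psi> \<in> test_functions \<Omega>"
  shows "(\<lambda>x. \<phi> x + \<psi> x) \<in> test_functions \<Omega>"
proof (rule test_functionsI)
  show "supp (\<lambda>x. \<phi> x + \<psi> x) \<subseteq> supp \<phi> \<union> supp \<psi>"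
    by (rule supp_subsetI) (simp_all add: closed_supp closed_Un not_in_supp)
qed (use assms in \<open>auto simp: test_functions_def smooth_add compact_Un\<close>)

lemma test_functions_zero: "(\<lambda>x. 0) \<in> test_functions \<Omega>"
  by (rule test_functionsI[where K="{}"]) (auto simp: smooth_const supp_def)

lemma test_linear_zero: "test_linear \<Omega> w \<Longrightarrow> w (\<lambda>x. 0) = 0"
  using test_functions_zero[of \<Omega>] by (fastforce simp: test_linear_def dest: spec[of _ 0])

lemma test_linear_sum:
  assumes w: "test_linear \<Omega> w" and "finite M" "\<And>m. m \<in> M \<Longrightarrow> f m \<in> test_functions \<Omega>"
  shows "(\<lambda>x. \<Sum>m\<in>M. f m x) \<in> test_functions \<Omega> \<and> w (\<lambda>x. \<Sum>m\<in>M. f m x) = (\<Sum>m\<in>M. w (f m))"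
  using assms(2,3)
proof (induction M rule: finite_induct)
  case empty
  show ?case using test_functions_zero test_linear_zero[OF w] by simp
next
  case (insert m M)
  then show ?case using w by (auto simp: test_linear_def intro: test_functions_add)
qed

lemma fourier_dist_mult: "fourier (dist_mult w \<theta>) k = w (\<lambda>x. \<theta> x * character k x)"
  by (simp add: fourier_def dist_mult_def character_def)

lemma iter_partial_scale:
  assumes "smooth f"
  shows "iter_partial ds (\<lambda>x. c * f x) = (\<lambda>x. c * iter_partial ds f x)"
proof (induction ds)
  case (Cons i ds)
  have "partial_deriv i (\<lambda>x. c) = (\<lambda>x. 0)" by (intro ext partial_deriv_eqI[OF has_derivative_const])
  then have "partial_deriv i (\<lambda>x. c * iter_partial ds f x) = (\<lambda>x. c * partial_deriv i (iter_partial ds f) x)"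
    using assms by (simp add: fun_eq_iff partial_deriv_mult smooth_differentiable smooth_const smooth_iter_partial)
  with Cons show ?case by simp
qed simp

text \<open>Merges finitely many constants by summing absolute values; applied to all derivatives up
  to a given order.\<close>

lemma uniform_constant:
  fixes h :: "'s \<Rightarrow> 'z \<Rightarrow> real"
  assumes "finite S" "\<And>s. s \<in> S \<Longrightarrow> \<exists>C. \<forall>z\<in>Z. h s z \<le> C * g z" and g: "\<And>z. z \<in> Z \<Longrightarrow> 0 \<le> g z"
  obtains C where "0 \<le> C" "\<And>s z. s \<in> S \<Longrightarrow> z \<in> Z \<Longrightarrow> h s z \<le> C * g z"
proof -
  obtain c where c: "\<And>s z. s \<in> S \<Longrightarrow> z \<in> Z \<Longrightarrow> h s z \<le> c s * g z"
    using assms(2) by metis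
  have "h s z \<le> (\<Sum>s\<in>S. \<bar>c s\<bar>) * g z" if "s \<in> S" "z \<in> Z" for s z
  proof -
    have "c s \<le> (\<Sum>s\<in>S. \<bar>c s\<bar>)"
      using member_le_sum[of s S "\<lambda>s. \<bar>c s\<bar>"] that assms(1) by simp
    then show ?thesis using c[OF that] mult_right_mono[OF _ g[OF that(2)]] by fastforce
  qed
  then show thesis by (rule that[rotated]) (auto intro: sum_nonneg)
qed

text \<open>On functions supported in K, a continuous seminorm is at most C times some
  \<open>Cm_norm m\<close>, which is a finite sum of suprema of derivatives.\<close>

lemma bounded_test_setI:
  assumes B: "B \<subseteq> test_functions \<Omega>" and K: "compact K" "K \<subseteq> \<Omega>" "\<And>b. b \<in> B \<Longrightarrow> supp b \<subseteq> K"
    and bound: "\<And>ds. \<exists>D. \<forall>b\<in>B. \<forall>x. norm (iter_partial ds b x) \<le> D"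
  shows "bounded_test_set \<Omega> B"
  unfolding bounded_test_set_def
proof (intro conjI allI impI B)
  fix p assume p: "continuous_test_seminorm \<Omega> p"
  obtain D where D: "\<And>ds b x. b \<in> B \<Longrightarrow> norm (iter_partial ds b x) \<le> D ds"
    using bound by metis
  obtain C m where C: "\<And>\<phi>. \<phi> \<in> test_functions \<Omega> \<Longrightarrow> supp \<phi> \<subseteq> K \<Longrightarrow> p \<phi> \<le> C * Cm_norm m \<phi>"
    using p K(1,2) unfolding continuous_test_seminorm_def by metis
  show "bdd_above (p ` B)"
  proof (rule bdd_aboveI2)
    fix b assume b: "b \<in> B"
    have "\<bar>Cm_norm m b\<bar> \<le> (\<Sum>ds | length ds \<le> m. D ds)"
      unfolding Cm_norm_def
    proof (rule order_trans[OF sum_abs], rule sum_mono)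
      fix ds
      show "\<bar>SUP x. norm (iter_partial ds b x)\<bar> \<le> D ds"
        by (rule cSup_abs_le) (use D[OF b] in auto)
    qed
    then have "C * Cm_norm m b \<le> \<bar>C\<bar> * (\<Sum>ds | length ds \<le> m. D ds)"
      by (metis abs_ge_self abs_ge_zero abs_mult mult_left_mono order_trans)
    then show "p b \<le> \<bar>C\<bar> * (\<Sum>ds | length ds \<le> m. D ds)"
      using C[of b] B K(3) b by fastforce
  qed
qed

lemma norm_freq_le:
  fixes m :: "'n::finite \<Rightarrow> int"
  assumes "m \<in> box_indices UNIV R"
  shows "norm (freq m :: real^'n) \<le> real CARD('n) * real R"
proof -
  have "norm (freq m :: real^'n) \<le> (\<Sum>i\<in>UNIV. \<bar>(freq m :: real^'n) $ i\<bar>)"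
    by (rule norm_le_l1_cart)
  also have "\<dots> \<le> (\<Sum>i\<in>(UNIV :: 'n set). real R)"
  proof (rule sum_mono)
    fix i :: 'n
    have "m i \<in> {- int R..int R}" using assms by (auto simp: box_indices_def)
    then show "\<bar>(freq m :: real^'n) $ i\<bar> \<le> real R" by (auto simp: freq_def abs_le_iff)
  qed
  finally show ?thesis by simp
qed

lemma card_box_indices: "card (box_indices (UNIV :: 'n::finite set) R) = (2 * R + 1) ^ CARD('n)"
proof -
  have "nat (2 * int R + 1) = 2 * R + 1" by simp
  then show ?thesis by (simp add: box_indices_def card_PiE)
qed

text \<open>The remainder \<open>\<phi> - T\<close> of the Fourier approximation with frequencies at most \<open>\<delta> * norm k\<close>
  decays faster than any power of \<open>norm k\<close> in every derivative, and so compensates the powers of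
  \<open>norm k\<close> produced by the weight and by differentiating the character.\<close>

lemma bounded_weighted_remainders:
  fixes \<theta> :: "real^'n \<Rightarrow> complex" and E :: "real^'n \<Rightarrow> real^'n \<Rightarrow> complex" and R :: "real^'n \<Rightarrow> nat"
  assumes \<theta>: "\<theta> \<in> test_functions \<Omega>" "supp \<theta> \<subseteq> S"
    and sE: "\<And>k. smooth (E k)"
    and E: "\<And>ds q. \<exists>C. \<forall>k. \<forall>x\<in>S. norm (iter_partial ds (E k) x) \<le> C / (1 + real (R k)) ^ q"
    and L: "\<And>k. 1 + norm k \<le> L * (1 + real (R k))"
  shows "bounded_test_set \<Omega> ((\<lambda>k x. of_real ((1 + norm k) powr N) * (\<theta> x * (character k x * E k x))) ` V)"
proof (rule bounded_test_setI[where K="supp \<theta>"])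
  let ?b = "\<lambda>k x. complex_of_real ((1 + norm k) powr N) * (\<theta> x * (character k x * E k x))"
  have tb: "?b k \<in> test_functions \<Omega>" for k
    by (intro test_functions_scale test_functions_mult \<theta> smooth_mult smooth_character sE)
  have sb: "supp (?b k) \<subseteq> supp \<theta>" for k
    by (rule supp_subsetI) (simp_all add: closed_supp not_in_supp)
  show "?b ` V \<subseteq> test_functions \<Omega>" using tb by blast
  show "supp b \<subseteq> supp \<theta>" if "b \<in> ?b ` V" for b using that sb by blast
  show "compact (supp \<theta>)" "supp \<theta> \<subseteq> \<Omega>" using \<theta> by (auto simp: test_functions_def)
  have s\<theta>: "smooth \<theta>" "compact (supp \<theta>)" using \<theta> by (auto simp: test_functions_def)
  fix ds :: "'n list"
  define M where "M = length ds"
  \<comment> \<open>M powers of 1 + |k| come from differentiating the character and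
    \<open>nat \<lceil>N\<rceil>\<close> from the weight; by the hypothesis on L, decay of order q
    in 1 + R k cancels both.\<close>
  define q where "q = M + nat \<lceil>N\<rceil>"
  have fin: "finite {es :: 'n list. length es \<le> M}" using finite_lists_length_le[of "UNIV :: 'n set" M] by simp
  obtain A where A: "0 \<le> A" "\<And>es x. length es \<le> M \<Longrightarrow> norm (iter_partial es \<theta> x) \<le> A"
  proof (rule uniform_constant[OF fin, where h="\<lambda>(es :: 'n list) x. norm (iter_partial es \<theta> x)" and Z=UNIV and g="\<lambda>_. 1"])
    show "\<exists>C. \<forall>x\<in>UNIV. norm (iter_partial es \<theta> x) \<le> C * 1" for es
      using bounded_iter_partial[OF s\<theta>, of es] by (metis mult.right_neutral)
  qed (auto intro: that)
  obtain C where C: "0 \<le> C" "\<And>es k x. length es \<le> M \<Longrightarrow> x \<in> S \<Longrightarrow> norm (iter_partial es (E k) x) \<le> C / (1 + real (R k)) ^ q"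
  proof (rule uniform_constant[OF fin, where h="\<lambda>(es :: 'n list) (k, x). norm (iter_partial es (E k) x)" and Z="UNIV \<times> S"
        and g="\<lambda>(k, x). 1 / (1 + real (R k)) ^ q"])
    show "\<exists>C. \<forall>z\<in>UNIV \<times> S. (case z of (k, x) \<Rightarrow> norm (iter_partial es (E k) x)) \<le>
        C * (case z of (k, x) \<Rightarrow> 1 / (1 + real (R k)) ^ q)" for es
      using E[of es q] by auto
  next
    fix C assume C: "0 \<le> C" "\<And>es z. es \<in> {es. length es \<le> M} \<Longrightarrow> z \<in> UNIV \<times> S \<Longrightarrow>
      (case z of (k, x) \<Rightarrow> norm (iter_partial es (E k) x)) \<le> C * (case z of (k, x) \<Rightarrow> 1 / (1 + real (R k)) ^ q)"
    show thesis
    proof (rule that[OF C(1)])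
      fix es :: "'n list" and k x assume "length es \<le> M" "x \<in> S"
      then show "norm (iter_partial es (E k) x) \<le> C / (1 + real (R k)) ^ q"
        using C(2)[of es "(k, x)"] by simp
    qed
  qed auto
  define D where "D = 2 ^ M * (A * (2 ^ M * C)) * L ^ q"
  have L0: "0 \<le> L"
  proof (rule ccontr)
    assume "\<not> 0 \<le> L"
    then have "L * (1 + real (R 0)) < 0" by (simp add: mult_neg_pos)
    with L[of 0] show False by simp
  qed
  \<comment> \<open>The bounds on \<open>E k\<close> hold on S only; off the support of \<theta> the
    product vanishes with all its derivatives.\<close>
  have "norm (iter_partial ds (?b k) x) \<le> D" for k x
  proof (cases "x \<in> supp \<theta>")
    case False
    then have "x \<notin> supp (iter_partial ds (?b k))" using sb[of k] supp_iter_partial[of ds "?b k"] by blast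
    then have "iter_partial ds (?b k) x = 0" by (rule not_in_supp)
    moreover have "0 \<le> D" using A(1) C(1) L0 by (simp add: D_def)
    ultimately show ?thesis by simp
  next
    case True
    define \<kappa> where "\<kappa> = 1 + norm k"
    define \<rho> where "\<rho> = 1 + real (R k)"
    have \<kappa>: "1 \<le> \<kappa>" "\<kappa> \<le> L * \<rho>" and \<rho>: "1 \<le> \<rho>" using L[of k] by (auto simp: \<kappa>_def \<rho>_def)
    have "norm (iter_partial es (character k) x) \<le> \<kappa> ^ M" if "length es \<le> M" for es
    proof -
      have "norm (iter_partial es (character k) x) \<le> norm k ^ length es" by (rule norm_iter_partial_character)
      also have "\<dots> \<le> \<kappa> ^ length es" by (intro power_mono) (auto simp: \<kappa>_def)
      also have "\<dots> \<le> \<kappa> ^ M" using that \<kappa>(1) by (intro power_increasing)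
      finally show ?thesis .
    qed
    then have ce: "norm (iter_partial es (\<lambda>x. character k x * E k x) x) \<le> 2 ^ M * (\<kappa> ^ M * (C / \<rho> ^ q))"
      if es: "length es \<le> M" for es
    proof -
      have "norm (iter_partial es (\<lambda>x. character k x * E k x) x) \<le> 2 ^ length es * (\<kappa> ^ M * (C / \<rho> ^ q))"
        using \<open>\<And>es. length es \<le> M \<Longrightarrow> norm (iter_partial es (character k) x) \<le> \<kappa> ^ M\<close> es C(2) True \<theta>(2)
        by (intro norm_iter_partial_mult smooth_character sE) (auto simp: \<rho>_def)
      also have "\<dots> \<le> 2 ^ M * (\<kappa> ^ M * (C / \<rho> ^ q))"
        using es C(1) \<kappa>(1) \<rho> by (intro mult_right_mono power_increasing) auto
      finally show ?thesis .
    qed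
    have "norm (iter_partial ds (\<lambda>x. \<theta> x * (character k x * E k x)) x) \<le> 2 ^ M * (A * (2 ^ M * (\<kappa> ^ M * (C / \<rho> ^ q))))"
      unfolding M_def
      by (intro norm_iter_partial_mult s\<theta> smooth_mult smooth_character sE A(2)[unfolded M_def] ce[unfolded M_def])
    moreover have "\<kappa> powr N \<le> \<kappa> ^ nat \<lceil>N\<rceil>"
    proof -
      have "\<kappa> powr N \<le> \<kappa> powr real (nat \<lceil>N\<rceil>)" using \<kappa>(1) by (intro powr_mono) linarith+
      then show ?thesis using \<kappa>(1) by (simp add: powr_realpow)
    qed
    ultimately have "\<kappa> powr N * norm (iter_partial ds (\<lambda>x. \<theta> x * (character k x * E k x)) x)
        \<le> \<kappa> ^ nat \<lceil>N\<rceil> * (2 ^ M * (A * (2 ^ M * (\<kappa> ^ M * (C / \<rho> ^ q)))))"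
      using \<kappa>(1) by (intro mult_mono) auto
    also have "\<dots> = 2 ^ M * (A * (2 ^ M * C)) * (\<kappa> / \<rho>) ^ q"
      by (simp add: q_def power_add power_divide)
    also have "\<dots> \<le> D"
      unfolding D_def using A(1) C(1) \<kappa> \<rho>
      by (intro mult_left_mono power_mono) (auto simp: pos_divide_le_eq)
    finally have "\<kappa> powr N * norm (iter_partial ds (\<lambda>x. \<theta> x * (character k x * E k x)) x) \<le> D" .
    moreover have "iter_partial ds (?b k) x = of_real (\<kappa> powr N) * iter_partial ds (\<lambda>x. \<theta> x * (character k x * E k x)) x"
      unfolding \<kappa>_def by (subst iter_partial_scale) (auto intro!: smooth_mult smooth_character sE s\<theta>)
    ultimately show ?thesis by (simp add: norm_mult)
  qed
  then show "\<exists>D. \<forall>b\<in>?b ` V. \<forall>x. norm (iter_partial ds b x) \<le> D" by blast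
qed

text \<open>For 2 |\<zeta>| \<le> |k| the weights at k and k - \<zeta> are comparable: 1 + |k| \<le>
  2 (1 + |k - \<zeta>|), whence the factor 2^P.\<close>

lemma fourier_shift_bound:
  fixes k :: "real^'n"
  assumes M: "\<And>\<eta>. \<eta> \<in> W \<Longrightarrow> (1 + norm \<eta>) powr real P * norm (f \<eta>) \<le> \<mu>"
    and \<eta>: "k - \<zeta> \<in> W" "2 * norm \<zeta> \<le> norm k"
  shows "norm (f (k - \<zeta>)) \<le> \<mu> * 2 ^ P / (1 + norm k) ^ P"
proof -
  have "norm k \<le> norm (k - \<zeta>) + norm \<zeta>" by norm
  then have "(1 + norm k) / 2 \<le> 1 + norm (k - \<zeta>)" using \<eta>(2) norm_ge_zero[of k] by argo
  then have "((1 + norm k) / 2) ^ P \<le> (1 + norm (k - \<zeta>)) ^ P" by (intro power_mono) auto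
  then have "((1 + norm k) / 2) ^ P * norm (f (k - \<zeta>)) \<le> (1 + norm (k - \<zeta>)) ^ P * norm (f (k - \<zeta>))"
    by (intro mult_right_mono) auto
  also have "\<dots> = (1 + norm (k - \<zeta>)) powr real P * norm (f (k - \<zeta>))"
    by (subst powr_realpow) (auto intro: add_pos_nonneg)
  also have "\<dots> \<le> \<mu>" by (rule M[OF \<eta>(1)])
  finally have "(1 + norm k) ^ P * norm (f (k - \<zeta>)) \<le> \<mu> * 2 ^ P"
    by (simp add: power_divide divide_simps)
  moreover have "0 < (1 + norm k) ^ P" by (simp add: add_pos_nonneg)
  ultimately show ?thesis by (simp add: pos_le_divide_eq mult.commute)
qed

text \<open>B, C and P are fixed before w, which enters only through its values on prescribed test
  functions and through the Fourier transform of \<theta> w on W. This uniformity is what a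
  comparison of topologies requires.\<close>

lemma micro_seminorm_localize:
  fixes \<phi> \<theta> :: "real^'n \<Rightarrow> complex"
  assumes \<theta>: "\<theta> \<in> test_functions \<Omega>" "supp \<theta> \<subseteq> closed_box a"
    and \<phi>: "smooth \<phi>" "compact (supp \<phi>)" "supp \<phi> \<subseteq> open_box a" and \<theta>\<phi>: "\<And>x. \<theta> x * \<phi> x = \<phi> x"
    and \<delta>: "0 < \<delta>" "\<delta> \<le> 1 / 2"
    and VW: "\<And>k \<zeta>. k \<in> V \<Longrightarrow> norm \<zeta> \<le> \<delta> * norm k \<Longrightarrow> k - \<zeta> \<in> W"
  obtains B C P where "bounded_test_set \<Omega> B" "0 < C"
    "\<And>w. test_linear \<Omega> w \<Longrightarrow> micro_seminorm N V \<phi> w \<le>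
       (SUP b\<in>B. ennreal (norm (w b))) + ennreal C * micro_seminorm (real (P :: nat)) W \<theta> w"
proof -
  obtain c A where c: "\<And>m. norm (c m) \<le> A" and
    E: "\<And>ds q. \<exists>C. \<forall>R. \<forall>x\<in>closed_box a. norm (iter_partial ds (\<lambda>x. \<phi> x -
       (\<Sum>m\<in>box_indices UNIV R. c m * character (- freq m) x)) x) \<le> C / (1 + real R) ^ q"
    by (rule fourier_approximation[OF \<phi>]) (rule that)
  have A0: "0 \<le> A" using c order_trans[OF norm_ge_zero] by blast
  define n where "n = CARD('n)"
  have n: "1 \<le> real n" using zero_less_card_finite[where 'a='n] by (simp add: n_def)
  \<comment> \<open>Frequencies in the index box of size R have norm at most n R; this R keeps them
    below \<delta> |k| while 1 + R stays comparable with 1 + |k|.\<close>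
  define R where "R k = nat \<lfloor>\<delta> * norm (k :: real^'n) / real n\<rfloor>" for k
  define T where "T k = (\<lambda>x. \<Sum>m\<in>box_indices UNIV (R k). c m * character (- freq m) x)" for k
  define E' where "E' k = (\<lambda>x. \<phi> x - T k x)" for k
  define b where "b k = (\<lambda>x. complex_of_real ((1 + norm k) powr N) * (\<theta> x * (character k x * E' k x)))" for k
  \<comment> \<open>The truncated sum has (2 R + 1)^n \<le> (1 + |k|)^n terms, which costs n powers
    of the weight.\<close>
  define P where "P = nat \<lceil>N\<rceil> + n"
  have R: "real (R k) \<le> \<delta> * norm k / real n" "\<delta> * norm k / real n < real (R k) + 1" for k
  proof -
    have "0 \<le> \<delta> * norm k / real n" using \<delta> n by simp
    then show "real (R k) \<le> \<delta> * norm k / real n" "\<delta> * norm k / real n < real (R k) + 1"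
      unfolding R_def by linarith+
  qed
  have freq_le: "norm (freq m :: real^'n) \<le> \<delta> * norm k" if "m \<in> box_indices UNIV (R k)" for m k
  proof -
    have "norm (freq m :: real^'n) \<le> real n * real (R k)" using norm_freq_le[OF that] by (simp add: n_def)
    also have "\<dots> \<le> real n * (\<delta> * norm k / real n)" by (intro mult_left_mono R) auto
    finally show ?thesis using n by simp
  qed
  have L: "1 + norm k \<le> (1 + real n / \<delta>) * (1 + real (R k))" for k
  proof -
    have "norm k = real n / \<delta> * (\<delta> * norm k / real n)" using \<delta> n by simp
    also have "\<dots> \<le> real n / \<delta> * (1 + real (R k))"
      using R(2)[of k] \<delta> n by (intro mult_left_mono) auto
    finally show ?thesis by (simp add: algebra_simps)
  qed
  have sT: "smooth (T k)" for k unfolding T_def by (intro smooth_sum smooth_scaled_character)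
  then have sE: "smooth (E' k)" for k unfolding E'_def by (intro smooth_diff \<phi>)
  have B: "bounded_test_set \<Omega> (b ` V)"
    unfolding b_def
  proof (rule bounded_weighted_remainders[OF \<theta> sE _ L])
    show "\<exists>C. \<forall>k. \<forall>x\<in>closed_box a. norm (iter_partial ds (E' k) x) \<le> C / (1 + real (R k)) ^ q" for ds q
      using E[of ds q] unfolding E'_def T_def by blast
  qed
  \<comment> \<open>The added 1 keeps C positive even if A = 0, so that the bound is trivial when
    the seminorm on the right is infinite.\<close>
  define C where "C = A * 2 ^ P + 1"
  show thesis
  proof (rule that[OF B, of C P])
    show "0 < C" using A0 by (simp add: C_def add_nonneg_pos)
    fix w :: "(real^'n \<Rightarrow> complex) \<Rightarrow> complex" assume w: "test_linear \<Omega> w"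
    let ?f = "fourier (dist_mult w \<theta>)"
    show "micro_seminorm N V \<phi> w \<le> (SUP b\<in>b ` V. ennreal (norm (w b))) + ennreal C * micro_seminorm (real P) W \<theta> w"
    proof (cases "micro_seminorm (real P) W \<theta> w")
      case top
      then show ?thesis using \<open>0 < C\<close> by (simp add: ennreal_mult_top)
    next
      case (real \<mu>)
      have \<mu>: "(1 + norm \<eta>) powr real P * norm (?f \<eta>) \<le> \<mu>" if "\<eta> \<in> W" for \<eta>
      proof -
        have "ennreal ((1 + norm \<eta>) powr real P * norm (?f \<eta>)) \<le> micro_seminorm (real P) W \<theta> w"
          unfolding micro_seminorm_def by (rule SUP_upper[OF that])
        then show ?thesis using real by (simp add: ennreal_le_iff)
      qed
      show ?thesis unfolding micro_seminorm_def[of N]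
      proof (rule SUP_least)
        fix k assume k: "k \<in> V"
        define \<kappa> where "\<kappa> = 1 + norm k"
        have \<kappa>: "1 \<le> \<kappa>" by (simp add: \<kappa>_def)
        let ?M = "box_indices (UNIV :: 'n set) (R k)"
        \<comment> \<open>Multiplying \<open>character k\<close> by the waves in \<open>T k\<close>
          shifts the frequency to \<open>k - freq m\<close>; the identity \<theta> \<phi> = \<phi>
          puts \<theta> in front of every term.\<close>
        have "(\<lambda>x. \<phi> x * character k x) = (\<lambda>x. \<theta> x * (character k x * E' k x) +
            (\<Sum>m\<in>?M. c m * (\<theta> x * character (k - freq m) x)))"
        proof
          fix x
          have "(\<Sum>m\<in>?M. c m * (\<theta> x * character (k - freq m) x)) = \<theta> x * character k x * T k x"
            using character_add[of k "- freq _" x]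
            by (simp add: T_def sum_distrib_left mult_ac)
          then have "\<theta> x * (character k x * E' k x) + (\<Sum>m\<in>?M. c m * (\<theta> x * character (k - freq m) x)) = (\<theta> x * \<phi> x) * character k x"
            by (simp add: E'_def algebra_simps)
          then show "\<phi> x * character k x = \<theta> x * (character k x * E' k x) + (\<Sum>m\<in>?M. c m * (\<theta> x * character (k - freq m) x))"
            by (simp add: \<theta>\<phi>)
        qed
        moreover have "(\<lambda>x. \<theta> x * (character k x * E' k x)) \<in> test_functions \<Omega>"
          by (intro test_functions_mult \<theta> smooth_mult smooth_character sE)
        moreover have t\<theta>: "(\<lambda>x. \<theta> x * character \<eta> x) \<in> test_functions \<Omega>" for \<eta>
          by (intro test_functions_mult \<theta> smooth_character)
        moreover from test_linear_sum[OF w, where M="?M" and f="\<lambda>m x. c m * (\<theta> x * character (k - freq m) x)"]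
        have "(\<lambda>x. \<Sum>m\<in>?M. c m * (\<theta> x * character (k - freq m) x)) \<in> test_functions \<Omega>"
          "w (\<lambda>x. \<Sum>m\<in>?M. c m * (\<theta> x * character (k - freq m) x)) = (\<Sum>m\<in>?M. w (\<lambda>x. c m * (\<theta> x * character (k - freq m) x)))"
          using test_functions_scale[OF t\<theta>] by auto
        ultimately have "fourier (dist_mult w \<phi>) k = w (\<lambda>x. \<theta> x * (character k x * E' k x)) + (\<Sum>m\<in>?M. c m * ?f (k - freq m))"
          using w by (simp add: fourier_dist_mult test_linear_def)
        then have "of_real (\<kappa> powr N) * fourier (dist_mult w \<phi>) k =
            w (b k) + of_real (\<kappa> powr N) * (\<Sum>m\<in>?M. c m * ?f (k - freq m))"
          using w \<open>(\<lambda>x. \<theta> x * (character k x * E' k x)) \<in> test_functions \<Omega>\<close>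
          by (simp add: b_def \<kappa>_def test_linear_def distrib_left)
        then have "\<kappa> powr N * norm (fourier (dist_mult w \<phi>) k) =
            norm (w (b k) + of_real (\<kappa> powr N) * (\<Sum>m\<in>?M. c m * ?f (k - freq m)))"
          by (metis abs_of_nonneg norm_mult norm_of_real powr_ge_zero)
        also have "\<dots> \<le> norm (w (b k)) + \<kappa> powr N * norm (\<Sum>m\<in>?M. c m * ?f (k - freq m))"
          by (rule order_trans[OF norm_triangle_ineq]) (simp add: norm_mult)
        also have "\<kappa> powr N * norm (\<Sum>m\<in>?M. c m * ?f (k - freq m)) \<le> C * \<mu>"
        proof -
          have "norm (\<Sum>m\<in>?M. c m * ?f (k - freq m)) \<le> (\<Sum>m\<in>?M. A * (\<mu> * 2 ^ P / \<kappa> ^ P))"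
          proof (rule sum_norm_le)
            fix m assume m: "m \<in> ?M"
            have "\<delta> * norm k \<le> norm k / 2" using mult_right_mono[OF \<delta>(2) norm_ge_zero[of k]] by simp
            then have "2 * norm (freq m :: real^'n) \<le> norm k" using freq_le[OF m] by linarith
            then have "norm (?f (k - freq m)) \<le> \<mu> * 2 ^ P / \<kappa> ^ P"
              unfolding \<kappa>_def by (intro fourier_shift_bound[where W=W] \<mu> VW k freq_le m)
            then show "norm (c m * ?f (k - freq m)) \<le> A * (\<mu> * 2 ^ P / \<kappa> ^ P)"
              unfolding norm_mult using A0 by (intro mult_mono c) auto
          qed
          also have "\<dots> = real (2 * R k + 1) ^ n * (A * (\<mu> * 2 ^ P / \<kappa> ^ P))"
            by (simp add: card_box_indices n_def)
          also have "\<dots> \<le> \<kappa> ^ n * (A * (\<mu> * 2 ^ P / \<kappa> ^ P))"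
          proof (intro mult_right_mono power_mono)
            have "\<delta> * norm k / real n \<le> (1 / 2 * norm k) / 1"
              using \<delta> n by (intro frac_le mult_right_mono) auto
            then have "real (R k) \<le> norm k / 2" using R(1)[of k] by linarith
            then show "real (2 * R k + 1) \<le> \<kappa>" by (simp add: \<kappa>_def)
            show "0 \<le> A * (\<mu> * 2 ^ P / \<kappa> ^ P)" using A0 real \<kappa> by simp
          qed simp
          finally have "\<kappa> powr N * norm (\<Sum>m\<in>?M. c m * ?f (k - freq m)) \<le> \<kappa> ^ nat \<lceil>N\<rceil> * (\<kappa> ^ n * (A * (\<mu> * 2 ^ P / \<kappa> ^ P)))"
          proof (intro mult_mono)
            have "\<kappa> powr N \<le> \<kappa> powr real (nat \<lceil>N\<rceil>)" using \<kappa> by (intro powr_mono) linarith+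
            then show "\<kappa> powr N \<le> \<kappa> ^ nat \<lceil>N\<rceil>" using \<kappa> by (simp add: powr_realpow)
          qed (use \<kappa> in auto)
          also have "\<dots> = A * 2 ^ P * \<mu>"
            using \<kappa> by (simp add: P_def power_add)
          also have "\<dots> \<le> C * \<mu>" using real by (intro mult_right_mono) (auto simp: C_def)
          finally show ?thesis .
        qed
        finally have "ennreal (\<kappa> powr N * norm (fourier (dist_mult w \<phi>) k)) \<le> ennreal (norm (w (b k)) + C * \<mu>)"
          by (intro ennreal_leI) simp
        also have "\<dots> = ennreal (norm (w (b k))) + ennreal C * ennreal \<mu>"
          using real \<open>0 < C\<close> by (simp add: ennreal_mult)
        also have "\<dots> \<le> (SUP b\<in>b ` V. ennreal (norm (w b))) + ennreal C * micro_seminorm (real P) W \<theta> w"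
          using k real by (intro add_mono SUP_upper) auto
        finally show "ennreal ((1 + norm k) powr N * norm (fourier (dist_mult w \<phi>) k)) \<le>
           (SUP b\<in>b ` V. ennreal (norm (w b))) + ennreal C * micro_seminorm (real P) W \<theta> w"
          by (simp add: \<kappa>_def)
      qed
    qed
  qed
qed

section \<open>Domination by a countable family\<close>

text \<open>Two functionals and two cutoffs appear on the right so that one lemma gives both the
  triangle inequality in the functional and subadditivity in the cutoff.\<close>

lemma micro_seminorm_mono:
  assumes "\<And>k. k \<in> V \<Longrightarrow> norm (fourier (dist_mult w \<theta>) k) \<le> norm (fourier (dist_mult w1 \<theta>1) k) + norm (fourier (dist_mult w2 \<theta>2) k)"
  shows "micro_seminorm N V \<theta> w \<le> micro_seminorm N V \<theta>1 w1 + micro_seminorm N V \<theta>2 w2"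
  unfolding micro_seminorm_def[of N V \<theta>]
proof (rule SUP_least)
  fix k assume k: "k \<in> V"
  let ?c = "(1 + norm k) powr N"
  have "ennreal (?c * norm (fourier (dist_mult w \<theta>) k)) \<le>
      ennreal (?c * norm (fourier (dist_mult w1 \<theta>1) k) + ?c * norm (fourier (dist_mult w2 \<theta>2) k))"
    using mult_left_mono[OF assms[OF k], of ?c] by (intro ennreal_leI) (simp add: distrib_left)
  also have "\<dots> \<le> micro_seminorm N V \<theta>1 w1 + micro_seminorm N V \<theta>2 w2"
    unfolding micro_seminorm_def by (simp, intro add_mono SUP_upper k)
  finally show "ennreal (?c * norm (fourier (dist_mult w \<theta>) k)) \<le> micro_seminorm N V \<theta>1 w1 + micro_seminorm N V \<theta>2 w2" .
qed

lemma micro_seminorm_triangle: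
  "micro_seminorm N V \<theta> (v - u) \<le> micro_seminorm N V \<theta> (v - z) + micro_seminorm N V \<theta> (z - u)"
proof (rule micro_seminorm_mono)
  fix k
  have "fourier (dist_mult (v - u) \<theta>) k = fourier (dist_mult (v - z) \<theta>) k + fourier (dist_mult (z - u) \<theta>) k"
    by (simp add: fourier_dist_mult)
  then show "norm (fourier (dist_mult (v - u) \<theta>) k) \<le> norm (fourier (dist_mult (v - z) \<theta>) k) + norm (fourier (dist_mult (z - u) \<theta>) k)"
    by (simp add: norm_triangle_ineq)
qed

lemma micro_seminorm_add:
  assumes w: "test_linear \<Omega> w" and "\<phi> \<in> test_functions \<Omega>" "\<psi> \<in> test_functions \<Omega>"
  shows "micro_seminorm N V (\<lambda>x. \<phi> x + \<psi> x) w \<le> micro_seminorm N V \<phi> w + micro_seminorm N V \<psi> w"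
proof (rule micro_seminorm_mono)
  fix k
  have "fourier (dist_mult w (\<lambda>x. \<phi> x + \<psi> x)) k = fourier (dist_mult w \<phi>) k + fourier (dist_mult w \<psi>) k"
    using w test_functions_mult[OF assms(2) smooth_character] test_functions_mult[OF assms(3) smooth_character]
    by (simp add: fourier_dist_mult test_linear_def distrib_right)
  then show "norm (fourier (dist_mult w (\<lambda>x. \<phi> x + \<psi> x)) k) \<le> norm (fourier (dist_mult w \<phi>) k) + norm (fourier (dist_mult w \<psi>) k)"
    by (simp add: norm_triangle_ineq)
qed

section \<open>Domination of seminorms and comparison of topologies\<close>

lemma SUP_ennreal_zero: "(\<And>x. x \<in> A \<Longrightarrow> f x = (0 :: ennreal)) \<Longrightarrow> (SUP x\<in>A. f x) = 0"
  by (metis SUP_least le_zero_eq order_refl)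

text \<open>Q0 and C are chosen before w; this uniformity carries neighbourhoods over. Both sides
  may be infinite.\<close>

definition dominated ::
    "(real^'n) set \<Rightarrow> (((real^'n \<Rightarrow> complex) \<Rightarrow> complex) \<Rightarrow> ennreal) set \<Rightarrow>
     (((real^'n \<Rightarrow> complex) \<Rightarrow> complex) \<Rightarrow> ennreal) \<Rightarrow> bool" where
  "dominated \<Omega> Q p \<longleftrightarrow> (\<exists>Q0 C. finite Q0 \<and> Q0 \<subseteq> Q \<and> (0::real) \<le> C \<and>
     (\<forall>w. test_linear \<Omega> w \<longrightarrow> p w \<le> ennreal C * (\<Sum>q\<in>Q0. q w)))"

lemma dominated_member: "q \<in> Q \<Longrightarrow> dominated \<Omega> Q q"
  unfolding dominated_def by (intro exI[of _ "{q}"] exI[of _ 1]) auto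

lemma dominated_combination:
  assumes "dominated \<Omega> Q p1" "dominated \<Omega> Q p2" "0 \<le> c"
    and le: "\<And>w. test_linear \<Omega> w \<Longrightarrow> p w \<le> p1 w + ennreal c * p2 w"
  shows "dominated \<Omega> Q p"
proof -
  obtain Q1 C1 where 1: "finite Q1" "Q1 \<subseteq> Q" "0 \<le> C1" "\<And>w. test_linear \<Omega> w \<Longrightarrow> p1 w \<le> ennreal C1 * (\<Sum>q\<in>Q1. q w)"
    using assms(1) unfolding dominated_def by blast
  obtain Q2 C2 where 2: "finite Q2" "Q2 \<subseteq> Q" "0 \<le> C2" "\<And>w. test_linear \<Omega> w \<Longrightarrow> p2 w \<le> ennreal C2 * (\<Sum>q\<in>Q2. q w)"
    using assms(2) unfolding dominated_def by blast
  have "p w \<le> ennreal (C1 + c * C2) * (\<Sum>q\<in>Q1 \<union> Q2. q w)" if w: "test_linear \<Omega> w" for w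
  proof -
    have "p w \<le> ennreal C1 * (\<Sum>q\<in>Q1. q w) + ennreal c * (ennreal C2 * (\<Sum>q\<in>Q2. q w))"
      by (rule order_trans[OF le[OF w]]) (intro add_mono mult_left_mono 1(4) 2(4) w, simp)
    also have "\<dots> \<le> ennreal C1 * (\<Sum>q\<in>Q1 \<union> Q2. q w) + ennreal c * (ennreal C2 * (\<Sum>q\<in>Q1 \<union> Q2. q w))"
      using 1(1) 2(1) by (intro add_mono mult_left_mono sum_mono2) auto
    also have "\<dots> = ennreal (C1 + c * C2) * (\<Sum>q\<in>Q1 \<union> Q2. q w)"
      using 1(3) 2(3) \<open>0 \<le> c\<close> by (simp add: ennreal_plus ennreal_mult distrib_right mult.assoc)
    finally show ?thesis .
  qed
  then show ?thesis
    unfolding dominated_def using 1 2 \<open>0 \<le> c\<close>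
    by (intro exI[of _ "Q1 \<union> Q2"] exI[of _ "C1 + c * C2"]) auto
qed

lemma openin_generated_subset:
  assumes "\<And>s. s \<in> S \<Longrightarrow> openin T s" "openin (topology_generated_by S) U"
  shows "openin T U"
  using assms(2) unfolding openin_topology_generated_by_iff
  by (induction rule: generate_topology_on.induct) (auto intro: assms(1))

lemma openin_seminorm_topology_space: "openin (seminorm_topology X Q) X"
  unfolding seminorm_topology_def by (rule topology_generated_by_Basis) simp

lemma openin_seminorm_topology_ball:
  "q \<in> Q \<Longrightarrow> u \<in> X \<Longrightarrow> 0 < e \<Longrightarrow> openin (seminorm_topology X Q) {v \<in> X. q (v - u) < ennreal e}"
  unfolding seminorm_topology_def by (rule topology_generated_by_Basis) blast

lemma seminorm_topology_le:
  assumes ball: "\<And>p u e. p \<in> P \<Longrightarrow> u \<in> X \<Longrightarrow> 0 < e \<Longrightarrow>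
      openin (seminorm_topology X Q) {v \<in> X. p (v - u) < ennreal e}"
    and U: "openin (seminorm_topology X P) U"
  shows "openin (seminorm_topology X Q) U"
proof (rule openin_generated_subset[OF _ U[unfolded seminorm_topology_def]])
  fix s assume "s \<in> insert X {{v \<in> X. p (v - u) < ennreal e} | p u e. p \<in> P \<and> u \<in> X \<and> 0 < e}"
  then show "openin (seminorm_topology X Q) s"
    by (elim insertE CollectE exE conjE) (simp_all add: ball openin_seminorm_topology_space)
qed

text \<open>A ball of p is open for Q because around each of its points z a finite intersection of
  Q-balls centred at z fits inside, by domination and the triangle inequality through z.\<close>

lemma seminorm_topology_eqI:
  fixes X :: "((real^'n \<Rightarrow> complex) \<Rightarrow> complex) set"
  assumes X: "X \<subseteq> distributions \<Omega>" and QP: "Q \<subseteq> P" and dom: "\<And>p. p \<in> P - Q \<Longrightarrow> dominated \<Omega> Q p"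
    and tri: "\<And>p u v z. p \<in> P - Q \<Longrightarrow> p (v - u) \<le> p (v - z) + p (z - u)"
    and zero: "\<And>q u. q \<in> Q \<Longrightarrow> q (u - u) = 0"
  shows "seminorm_topology X P = seminorm_topology X Q"
proof -
  let ?T = "seminorm_topology X Q"
  have "openin ?T {v \<in> X. p (v - u) < ennreal e}" if p: "p \<in> P" and u: "u \<in> X" and e: "0 < e" for p u e
  proof (cases "p \<in> Q")
    case True
    then show ?thesis using u e by (rule openin_seminorm_topology_ball)
  next
    case False
    with p have p: "p \<in> P - Q" by simp
    obtain Q0 C where Q0: "finite Q0" "Q0 \<subseteq> Q" "0 \<le> C"
      and C: "\<And>w. test_linear \<Omega> w \<Longrightarrow> p w \<le> ennreal C * (\<Sum>q\<in>Q0. q w)"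
      using dom[OF p] unfolding dominated_def by blast
    show ?thesis
    proof (subst openin_subopen, intro ballI)
      fix z assume z: "z \<in> {v \<in> X. p (v - u) < ennreal e}"
      \<comment> \<open>p may be infinite elsewhere, but membership in the ball makes p (z - u) a
        real number d < e.\<close>
      then have "p (z - u) < top" by (auto intro: order.strict_trans[OF _ ennreal_less_top])
      then obtain d where d: "0 \<le> d" "p (z - u) = ennreal d" by (cases "p (z - u)") auto
      with z e have "d < e" by (simp add: ennreal_less_iff)
      \<comment> \<open>Ensures C card(Q0) \<epsilon> < e - d; the 1 makes this strict and prevents
        division by zero.\<close>
      define \<epsilon> where "\<epsilon> = (e - d) / (C * real (card Q0) + 1)"
      have pos: "0 < C * real (card Q0) + 1" using Q0(3) by (simp add: add_nonneg_pos)
      have \<epsilon>: "0 < \<epsilon>" using pos \<open>d < e\<close> by (simp add: \<epsilon>_def)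
      \<comment> \<open>X is inserted so that U lies in X even when Q0 is empty.\<close>
      define U where "U = \<Inter> (insert X ((\<lambda>q. {v \<in> X. q (v - z) < ennreal \<epsilon>}) ` Q0))"
      have "openin ?T U"
        unfolding U_def using Q0 z \<epsilon>
        by (intro openin_Inter) (auto intro: openin_seminorm_topology_space openin_seminorm_topology_ball)
      moreover have "q (z - z) < ennreal \<epsilon>" if "q \<in> Q0" for q
        using zero[of q z] that Q0(2) \<epsilon> by auto
      then have "z \<in> U" using z \<epsilon> by (auto simp: U_def)
      moreover have "U \<subseteq> {v \<in> X. p (v - u) < ennreal e}"
      proof
        fix v assume v: "v \<in> U"
        then have "v \<in> X" by (simp add: U_def)
        have "(\<Sum>q\<in>Q0. q (v - z)) \<le> of_nat (card Q0) * ennreal \<epsilon>"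
          using v by (intro sum_bounded_above) (auto simp: U_def intro: less_imp_le)
        moreover have "test_linear \<Omega> (v - z)" using X \<open>v \<in> X\<close> z by (intro test_linear_diff) auto
        ultimately have "p (v - z) \<le> ennreal C * (of_nat (card Q0) * ennreal \<epsilon>)"
          by (intro order_trans[OF C] mult_left_mono) simp_all
        also have "\<dots> = ennreal (C * real (card Q0) * \<epsilon>)"
          using Q0(3) \<epsilon> by (simp add: ennreal_of_nat_eq_real_of_nat ennreal_mult mult.assoc)
        finally have "p (v - u) \<le> ennreal (C * real (card Q0) * \<epsilon>) + ennreal d"
          using tri[OF p, of v u z] d(2) by (metis add_right_mono order_trans)
        also have "\<dots> = ennreal (C * real (card Q0) * \<epsilon> + d)"
          using Q0(3) \<epsilon> d(1) by (simp add: ennreal_plus)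
        also have "C * real (card Q0) * \<epsilon> + d < e"
        proof -
          have "(C * real (card Q0) + 1) * \<epsilon> = e - d" using pos by (simp add: \<epsilon>_def)
          then show ?thesis using \<epsilon> by (simp add: algebra_simps)
        qed
        then have "ennreal (C * real (card Q0) * \<epsilon> + d) < ennreal e" using e by (simp add: ennreal_lessI)
        finally show "v \<in> {v \<in> X. p (v - u) < ennreal e}" using \<open>v \<in> X\<close> by simp
      qed
      ultimately show "\<exists>T. openin ?T T \<and> z \<in> T \<and> T \<subseteq> {v \<in> X. p (v - u) < ennreal e}" by blast
    qed
  qed
  then have "openin ?T U" if "openin (seminorm_topology X P) U" for U
    using seminorm_topology_le[OF _ that] by blast
  moreover have "openin (seminorm_topology X P) U" if "openin ?T U" for U
    by (rule seminorm_topology_le[OF openin_seminorm_topology_ball that]) (use QP in auto)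
  ultimately show ?thesis by (auto simp: topology_eq)
qed

section \<open>Closed cones of directions at positive distance from \<Gamma>\<close>

definition cone_away :: "((real^'n) \<times> (real^'n)) set \<Rightarrow> (real^'n) set \<Rightarrow> nat \<Rightarrow> (real^'n) set" where
  "cone_away \<Gamma> K j = {k. \<forall>y\<in>K. \<forall>\<xi>. (y, \<xi>) \<in> \<Gamma> \<and> norm \<xi> = 1 \<longrightarrow> norm k / real (Suc j) \<le> norm (k - norm k *\<^sub>R \<xi>)}"

text \<open>With |k| multiplied through, the condition on directions becomes a non-strict inequality
  between continuous functions of k, meaningful at k = 0 too.\<close>

lemma closed_cone_away: "closed (cone_away \<Gamma> K j)"
proof -
  have "cone_away \<Gamma> K j = (\<Inter>y\<in>K. \<Inter>\<xi>\<in>{\<xi>. (y, \<xi>) \<in> \<Gamma> \<and> norm \<xi> = 1}. {k. norm k / real (Suc j) \<le> norm (k - norm k *\<^sub>R \<xi>)})"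
    by (auto simp: cone_away_def)
  also have "closed \<dots>"
    by (intro closed_INT ballI closed_Collect_le continuous_intros) auto
  finally show ?thesis .
qed

lemma pos_cone_cone_away: "pos_cone (cone_away \<Gamma> K j)"
  unfolding pos_cone_def
proof (intro ballI allI impI)
  fix k and c :: real assume k: "k \<in> cone_away \<Gamma> K j" and c: "0 < c"
  have "norm (c *\<^sub>R k) / real (Suc j) \<le> norm (c *\<^sub>R k - norm (c *\<^sub>R k) *\<^sub>R \<xi>)"
    if "y \<in> K" "(y, \<xi>) \<in> \<Gamma>" "norm \<xi> = 1" for y \<xi>
  proof -
    have "norm (c *\<^sub>R k) / real (Suc j) = c * (norm k / real (Suc j))" using c by simp
    also have "\<dots> \<le> c * norm (k - norm k *\<^sub>R \<xi>)"
      using k that c by (intro mult_left_mono) (auto simp: cone_away_def)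
    also have "\<dots> = norm (c *\<^sub>R (k - norm k *\<^sub>R \<xi>))" using c by simp
    also have "c *\<^sub>R (k - norm k *\<^sub>R \<xi>) = c *\<^sub>R k - norm (c *\<^sub>R k) *\<^sub>R \<xi>"
      using c by (simp add: scaleR_diff_right)
    finally show ?thesis .
  qed
  then show "c *\<^sub>R k \<in> cone_away \<Gamma> K j" by (auto simp: cone_away_def)
qed

text \<open>For k in \<Gamma> over y, the direction k / |k| is itself one of the covectors \<xi> to
  be avoided; k = 0 does not occur in \<Gamma>.\<close>

lemma cone_away_disjoint:
  assumes \<Gamma>: "closed_cotangent_cone \<Omega> \<Gamma>"
  shows "(K \<times> cone_away \<Gamma> K j) \<inter> \<Gamma> = {}"
proof (intro equals0I, elim IntE SigmaE, simp)
  fix y k assume y: "y \<in> K" and k: "k \<in> cone_away \<Gamma> K j" and yk: "(y, k) \<in> \<Gamma>"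
  have "\<Gamma> \<subseteq> \<Omega> \<times> (UNIV - {0})"
    using \<Gamma> by (simp add: closed_cotangent_cone_def closedin_def)
  with yk have k0: "k \<noteq> 0" by auto
  with yk \<Gamma> have "(y, (1 / norm k) *\<^sub>R k) \<in> \<Gamma>"
    unfolding closed_cotangent_cone_def by (metis (no_types, lifting) case_prodD divide_pos_pos zero_less_norm_iff zero_less_one)
  moreover have "norm ((1 / norm k) *\<^sub>R k) = 1" using k0 by simp
  ultimately have "norm k / real (Suc j) \<le> norm (k - norm k *\<^sub>R ((1 / norm k) *\<^sub>R k))"
    using k y unfolding cone_away_def by blast
  with k0 show False by (simp add: divide_le_0_iff)
qed

text \<open>The radii tend to 0 and stay at most 1/2, so that balls of radius 4
  \<open>radius l\<close> \<le> 2 fit into a box of half-side pi.\<close>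

definition radius :: "nat \<Rightarrow> real" where
  "radius l = 1 / (2 + real l)"

lemma radius_pos: "0 < radius l" and radius_le: "radius l \<le> 1 / 2"
  by (auto simp: radius_def)

lemma radius_small:
  assumes "0 < e" obtains l where "radius l < e"
proof -
  obtain n where "1 / (real (Suc n)) < e" using nat_approx_posE[OF assms] by blast
  moreover have "radius n \<le> 1 / real (Suc n)" unfolding radius_def by (intro divide_left_mono) auto
  ultimately show thesis by (intro that[of n]) simp
qed

text \<open>The unit covectors of V over x form a compact set that misses \<Gamma>; part of the
  resulting distance survives over nearby points y.\<close>

lemma cone_separation:
  assumes \<Omega>: "open \<Omega>" and \<Gamma>: "closed_cotangent_cone \<Omega> \<Gamma>" and V: "closed V" "pos_cone V"
    and x: "x \<in> \<Omega>" "\<And>k. k \<in> V \<Longrightarrow> (x, k) \<notin> \<Gamma>"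
  obtains s e where "0 < s" "cball x s \<subseteq> \<Omega>" "0 < e" "e \<le> 1"
    "\<And>y k \<xi>. y \<in> cball x s \<Longrightarrow> k \<in> V \<Longrightarrow> (y, \<xi>) \<in> \<Gamma> \<Longrightarrow> norm \<xi> = 1 \<Longrightarrow> e * norm k \<le> norm (k - norm k *\<^sub>R \<xi>)"
proof -
  obtain s where s: "0 < s" "cball x s \<subseteq> \<Omega>"
    using \<Omega> x(1) open_contains_cball by blast
  obtain T where T: "closed T" "\<Gamma> = (\<Omega> \<times> (UNIV - {0})) \<inter> T"
    using \<Gamma> unfolding closed_cotangent_cone_def closedin_closed by blast
  \<comment> \<open>\<Gamma> is closed only relative to \<Omega> and nonzero covectors; over a
    closed ball inside \<Omega> and on the unit sphere it becomes closed outright.\<close>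
  have "\<Gamma> \<inter> (cball x s \<times> sphere 0 1) = T \<inter> (cball x s \<times> sphere 0 1)"
    using s T(2) by auto
  then have "closed (\<Gamma> \<inter> (cball x s \<times> sphere 0 1))"
    using T(1) by (simp add: closed_Int closed_Times)
  moreover have "compact ({x} \<times> (V \<inter> sphere 0 1))"
    by (intro compact_Times closed_Int_compact V) auto
  moreover have "({x} \<times> (V \<inter> sphere 0 1)) \<inter> (\<Gamma> \<inter> (cball x s \<times> sphere 0 1)) = {}"
    using x(2) by auto
  ultimately obtain d where d: "0 < d"
    "\<And>a b. a \<in> {x} \<times> (V \<inter> sphere 0 1) \<Longrightarrow> b \<in> \<Gamma> \<inter> (cball x s \<times> sphere 0 1) \<Longrightarrow> d \<le> dist a b"
    using separate_compact_closed by metis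
  \<comment> \<open>Half of d pays for moving from x to y, the other half separates directions; the
    minimum with 1 serves \<open>cone_perturbation\<close>.\<close>
  define e where "e = min (d / 2) 1"
  show thesis
  proof (rule that[of "min s (d / 2)" e])
    show "0 < min s (d / 2)" "cball x (min s (d / 2)) \<subseteq> \<Omega>" "0 < e" "e \<le> 1"
      using s d(1) by (auto simp: e_def)
    fix y k \<xi> assume y: "y \<in> cball x (min s (d / 2))" and k: "k \<in> V" and \<xi>: "(y, \<xi>) \<in> \<Gamma>" "norm \<xi> = 1"
    show "e * norm k \<le> norm (k - norm k *\<^sub>R \<xi>)"
    proof (cases "k = 0")
      case False
      define \<omega> where "\<omega> = (1 / norm k) *\<^sub>R k"
      have \<omega>: "\<omega> \<in> V" "norm \<omega> = 1" using V(2) k False by (auto simp: \<omega>_def pos_cone_def)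
      have "d \<le> dist (x, \<omega>) (y, \<xi>)" using \<omega> \<xi> y by (intro d(2)) auto
      also have "\<dots> \<le> dist x y + dist \<omega> \<xi>"
        unfolding dist_Pair_Pair by (rule sqrt_sum_squares_le_sum) auto
      finally have "e \<le> norm (\<omega> - \<xi>)" using y by (auto simp: e_def dist_norm)
      then have "norm k * e \<le> norm k * norm (\<omega> - \<xi>)" by (intro mult_left_mono) auto
      also have "\<dots> = norm (norm k *\<^sub>R (\<omega> - \<xi>))" by simp
      also have "norm k *\<^sub>R (\<omega> - \<xi>) = k - norm k *\<^sub>R \<xi>" using False by (simp add: \<omega>_def scaleR_diff_right)
      finally show ?thesis by (simp add: mult.commute)
    qed simp
  qed
qed

text \<open>Passing from k to k - \<zeta> changes k - |k| \<xi> by at most 2 |\<zeta>| \<le> e |k| /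
  2, so e |k| / 2 remains; then |k - \<zeta>| \<le> 2 |k| leaves e / 4.\<close>

lemma cone_perturbation:
  fixes k \<zeta> \<xi> :: "real^'n"
  assumes e: "0 < e" "e \<le> 1" and k: "e * norm k \<le> norm (k - norm k *\<^sub>R \<xi>)" and \<xi>: "norm \<xi> = 1"
    and \<zeta>: "norm \<zeta> \<le> e / 4 * norm k"
  shows "e / 4 * norm (k - \<zeta>) \<le> norm ((k - \<zeta>) - norm (k - \<zeta>) *\<^sub>R \<xi>)"
proof -
  have "k - norm k *\<^sub>R \<xi> = ((k - \<zeta>) - norm (k - \<zeta>) *\<^sub>R \<xi>) + (\<zeta> - (norm k - norm (k - \<zeta>)) *\<^sub>R \<xi>)"
    by (simp add: algebra_simps)
  also have "norm \<dots> \<le> norm ((k - \<zeta>) - norm (k - \<zeta>) *\<^sub>R \<xi>) + (norm \<zeta> + norm \<zeta>)"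
  proof (rule order_trans[OF norm_triangle_ineq], rule add_left_mono)
    have "\<bar>norm k - norm (k - \<zeta>)\<bar> \<le> norm \<zeta>" using norm_triangle_ineq3[of k "k - \<zeta>"] by simp
    then show "norm (\<zeta> - (norm k - norm (k - \<zeta>)) *\<^sub>R \<xi>) \<le> norm \<zeta> + norm \<zeta>"
      using \<xi> by (intro order_trans[OF norm_triangle_ineq4]) simp
  qed
  finally have 1: "e / 2 * norm k \<le> norm ((k - \<zeta>) - norm (k - \<zeta>) *\<^sub>R \<xi>)" using k \<zeta> by simp
  have "e / 4 * norm k \<le> 1 * norm k" using e by (intro mult_right_mono) auto
  then have "norm (k - \<zeta>) \<le> 2 * norm k" using norm_triangle_ineq4[of k \<zeta>] \<zeta> by linarith
  then have "e / 4 * norm (k - \<zeta>) \<le> e / 4 * (2 * norm k)" using e by (intro mult_left_mono) auto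
  with 1 show ?thesis by simp
qed

text \<open>Collects what localization near q requires. One, two and four times
  \<open>radius l\<close> are the radii of the covering ball, of the support of the piece cut out
  there, and of the support of the larger bump.\<close>

definition good_index :: "(real^'n) set \<Rightarrow> ((real^'n) \<times> (real^'n)) set \<Rightarrow> (real^'n) set \<Rightarrow> real^'n \<Rightarrow> nat \<Rightarrow> nat \<Rightarrow> bool" where
  "good_index \<Omega> \<Gamma> V q l j \<longleftrightarrow> cball q (4 * radius l) \<subseteq> \<Omega> \<and>
     (\<exists>\<delta>. 0 < \<delta> \<and> \<delta> \<le> 1 / 2 \<and> (\<forall>k\<in>V. \<forall>\<zeta>. norm \<zeta> \<le> \<delta> * norm k \<longrightarrow> k - \<zeta> \<in> cone_away \<Gamma> (cball q (4 * radius l)) j))"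

lemma good_index_exists:
  fixes D :: "(real^'n) set"
  assumes "open \<Omega>" "closed_cotangent_cone \<Omega> \<Gamma>" "closed V" "pos_cone V"
    and "x \<in> \<Omega>" "\<And>k. k \<in> V \<Longrightarrow> (x, k) \<notin> \<Gamma>"
    and D: "\<And>X. open X \<Longrightarrow> X \<noteq> {} \<Longrightarrow> \<exists>q\<in>D. q \<in> X"
  shows "\<exists>q\<in>D. \<exists>l j. x \<in> ball q (radius l) \<and> good_index \<Omega> \<Gamma> V q l j"
proof -
  obtain s e where s: "0 < s" "cball x s \<subseteq> \<Omega>" and e: "0 < e" "e \<le> 1"
    and sep: "\<And>y k \<xi>. y \<in> cball x s \<Longrightarrow> k \<in> V \<Longrightarrow> (y, \<xi>) \<in> \<Gamma> \<Longrightarrow> norm \<xi> = 1 \<Longrightarrow> e * norm k \<le> norm (k - norm k *\<^sub>R \<xi>)"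
    by (rule cone_separation[OF assms(1-6)]) (assumption, rule that)
  \<comment> \<open>From x to q costs one radius and from q to a point of the large ball four, five
    in all.\<close>
  obtain l where l: "radius l < s / 5" using radius_small[of "s / 5"] s(1) by auto
  obtain q where q: "q \<in> D" "q \<in> ball x (radius l)" using D[of "ball x (radius l)"] radius_pos[of l] by auto
  have sub: "cball q (4 * radius l) \<subseteq> cball x s"
  proof
    fix y assume "y \<in> cball q (4 * radius l)"
    then show "y \<in> cball x s" using q(2) l dist_triangle[of x y q] by simp
  qed
  obtain j where j: "1 / real (Suc j) < e / 4" using nat_approx_posE[of "e / 4"] e(1) by auto
  have "k - \<zeta> \<in> cone_away \<Gamma> (cball q (4 * radius l)) j" if k: "k \<in> V" and \<zeta>: "norm \<zeta> \<le> e / 4 * norm k" for k \<zeta>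
    unfolding cone_away_def
  proof (intro CollectI ballI allI impI, elim conjE)
    fix y \<xi> assume "y \<in> cball q (4 * radius l)" "(y, \<xi>) \<in> \<Gamma>" "norm \<xi> = 1"
    then have "e / 4 * norm (k - \<zeta>) \<le> norm ((k - \<zeta>) - norm (k - \<zeta>) *\<^sub>R \<xi>)"
      using sub sep k by (intro cone_perturbation e \<zeta>) auto
    moreover have "norm (k - \<zeta>) / real (Suc j) \<le> e / 4 * norm (k - \<zeta>)"
      using mult_right_mono[OF less_imp_le[OF j] norm_ge_zero[of "k - \<zeta>"]] by simp
    ultimately show "norm (k - \<zeta>) / real (Suc j) \<le> norm (k - \<zeta> - norm (k - \<zeta>) *\<^sub>R \<xi>)" by linarith
  qed
  then have "good_index \<Omega> \<Gamma> V q l j"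
    unfolding good_index_def using sub s(2) e by (intro conjI exI[of _ "e / 4"]) auto
  moreover have "x \<in> ball q (radius l)" using q(2) by (simp add: dist_commute)
  ultimately show ?thesis using q(1) by blast
qed

section \<open>The countable family and domination by it\<close>

definition countable_family ::
    "(real^'n) set \<Rightarrow> ((real^'n) \<times> (real^'n)) set \<Rightarrow> (real^'n) set \<Rightarrow> ((real^'n \<Rightarrow> complex) \<times> (real^'n) set) set" where
  "countable_family \<Omega> \<Gamma> D =
     (\<lambda>(q, l, j). (bump q (2 * radius l), cone_away \<Gamma> (cball q (4 * radius l)) j)) `
       {(q, l, j). q \<in> D \<and> cball q (4 * radius l) \<subseteq> \<Omega>}"

lemma countable_countable_family:
  assumes "countable D" shows "countable (countable_family \<Omega> \<Gamma> D)"
proof -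
  have "countable (D \<times> (UNIV :: (nat \<times> nat) set))" by (intro countable_SIGMA assms countableI_type)
  then have "countable {(q, l, j :: nat). q \<in> D \<and> cball q (4 * radius l) \<subseteq> \<Omega>}"
    by (rule countable_subset[rotated]) auto
  then show ?thesis unfolding countable_family_def by (rule countable_image)
qed

lemma supp_large_bump: "supp (bump q (2 * radius l)) \<subseteq> cball q (4 * radius l)"
  using supp_bump[of "2 * radius l" q] radius_pos[of l] by simp

lemma large_bump_test_function:
  "cball q (4 * radius l) \<subseteq> \<Omega> \<Longrightarrow> bump q (2 * radius l) \<in> test_functions \<Omega>"
  by (rule test_functionsI[OF smooth_bump compact_cball supp_large_bump])

lemma countable_family_admissible:
  assumes "closed_cotangent_cone \<Omega> \<Gamma>" "(\<theta>, V) \<in> countable_family \<Omega> \<Gamma> D"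
  shows "admissible_pair \<Omega> \<Gamma> \<theta> V"
proof -
  obtain q l j where "cball q (4 * radius l) \<subseteq> \<Omega>" and \<theta>: "\<theta> = bump q (2 * radius l)"
    and V: "V = cone_away \<Gamma> (cball q (4 * radius l)) j"
    using assms(2) by (auto simp: countable_family_def)
  moreover have "(supp \<theta> \<times> V) \<inter> \<Gamma> = {}"
    using cone_away_disjoint[OF assms(1), of "cball q (4 * radius l)" j] supp_large_bump[of q l]
    unfolding \<theta> V by blast
  ultimately show ?thesis
    by (simp add: admissible_pair_def large_bump_test_function closed_cone_away pos_cone_cone_away)
qed

definition countable_seminorms ::
    "(real^'n) set \<Rightarrow> ((real^'n \<Rightarrow> complex) \<times> (real^'n) set) set \<Rightarrow> (((real^'n \<Rightarrow> complex) \<Rightarrow> complex) \<Rightarrow> ennreal) set" where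
  "countable_seminorms \<Omega> F = strong_seminorms \<Omega> \<union> {micro_seminorm (real N) V \<theta> | (N::nat) V \<theta>. (\<theta>, V) \<in> F}"

text \<open>Localization with the box centred at q: the larger bump equals 1 where \<phi> can be
  nonzero, and \<delta> is the opening provided by the good index.\<close>

lemma good_index_dominated:
  assumes q: "q \<in> D" and good: "good_index \<Omega> \<Gamma> V q l j"
    and \<phi>: "smooth \<phi>" "\<And>x. x \<notin> cball q (2 * radius l) \<Longrightarrow> \<phi> x = 0"
  shows "dominated \<Omega> (countable_seminorms \<Omega> (countable_family \<Omega> \<Gamma> D)) (micro_seminorm N V \<phi>)"
proof -
  let ?\<theta> = "bump q (2 * radius l)" and ?W = "cone_away \<Gamma> (cball q (4 * radius l)) j"
  let ?Q = "countable_seminorms \<Omega> (countable_family \<Omega> \<Gamma> D)"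
  obtain \<delta> where sub: "cball q (4 * radius l) \<subseteq> \<Omega>" and \<delta>: "0 < \<delta>" "\<delta> \<le> 1 / 2"
    "\<And>k \<zeta>. k \<in> V \<Longrightarrow> norm \<zeta> \<le> \<delta> * norm k \<Longrightarrow> k - \<zeta> \<in> ?W"
    using good unfolding good_index_def by blast
  have r: "0 < radius l" "4 * radius l \<le> pi" "2 * radius l < pi"
    using radius_pos[of l] radius_le[of l] pi_gt3 by auto
  have "(?\<theta>, ?W) \<in> countable_family \<Omega> \<Gamma> D"
    unfolding countable_family_def using q sub by (intro image_eqI[of _ _ "(q, l, j)"]) auto
  then have member: "micro_seminorm (real P) ?W ?\<theta> \<in> ?Q" for P
    unfolding countable_seminorms_def by blast
  have supp: "supp \<phi> \<subseteq> cball q (2 * radius l)" by (rule supp_subsetI) (use \<phi> in auto)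
  have "bump q (2 * radius l) x * \<phi> x = \<phi> x" for x
    using bump_eq_1[of q x "2 * radius l"] \<phi>(2)[of x] r by fastforce
  note localize = micro_seminorm_localize[OF large_bump_test_function[OF sub]
      order_trans[OF supp_large_bump cball_subset_closed_box[OF r(2)]] \<phi>(1)
      compact_supp_subset[OF compact_cball supp] order_trans[OF supp cball_subset_open_box[OF r(3)]] this \<delta>(1,2), where V=V and W="?W" and N=N]
  obtain B C P where B: "bounded_test_set \<Omega> B" and C: "0 < C"
    "\<And>w. test_linear \<Omega> w \<Longrightarrow> micro_seminorm N V \<phi> w \<le>
       (SUP b\<in>B. ennreal (norm (w b))) + ennreal C * micro_seminorm (real P) ?W ?\<theta> w"
  proof (rule localize)
    show "k - \<zeta> \<in> ?W" if "k \<in> V" "norm \<zeta> \<le> \<delta> * norm k" for k \<zeta>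
      using that by (rule \<delta>(3))
  qed (rule that)
  have "(\<lambda>w. SUP b\<in>B. ennreal (norm (w b))) \<in> ?Q"
    unfolding countable_seminorms_def strong_seminorms_def using B by blast
  then show ?thesis
    using C by (intro dominated_combination[OF dominated_member dominated_member[OF member] less_imp_le]) auto
qed

text \<open>In place of a partition of unity, bumps b are split off one covering ball at a time:
  \<phi> b is localized, and \<phi> (1 - b) vanishes on that ball, so fewer balls remain.\<close>

lemma micro_seminorm_dominated:
  fixes \<Omega> :: "(real^'n) set"
  assumes \<Omega>: "open \<Omega>" and \<Gamma>: "closed_cotangent_cone \<Omega> \<Gamma>" and adm: "admissible_pair \<Omega> \<Gamma> \<theta> V"
    and D: "\<And>X. open X \<Longrightarrow> X \<noteq> {} \<Longrightarrow> \<exists>q\<in>D. q \<in> X"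
  shows "dominated \<Omega> (countable_seminorms \<Omega> (countable_family \<Omega> \<Gamma> D)) (micro_seminorm N V \<theta>)"
proof -
  let ?Q = "countable_seminorms \<Omega> (countable_family \<Omega> \<Gamma> D)"
  define G where "G = {(q, l, j). q \<in> D \<and> good_index \<Omega> \<Gamma> V q l j}"
  define U where "U = (\<lambda>(q :: real^'n, l :: nat, j :: nat). ball q (radius l))"
  have "supp \<theta> \<subseteq> (\<Union>z\<in>G. U z)"
  proof
    fix x assume x: "x \<in> supp \<theta>"
    then have "x \<in> \<Omega>" "\<And>k. k \<in> V \<Longrightarrow> (x, k) \<notin> \<Gamma>" "closed V" "pos_cone V"
      using adm by (auto simp: admissible_pair_def test_functions_def)
    then obtain q l j where "q \<in> D" "x \<in> ball q (radius l)" "good_index \<Omega> \<Gamma> V q l j"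
      using good_index_exists[OF \<Omega> \<Gamma>, of V x D] D by blast
    then have "x \<in> U (q, l, j)" "(q, l, j) \<in> G" by (auto simp: U_def G_def)
    then show "x \<in> (\<Union>z\<in>G. U z)" by blast
  qed
  moreover have "compact (supp \<theta>)" using adm by (auto simp: admissible_pair_def test_functions_def)
  moreover have "open (U z)" for z by (simp add: U_def case_prod_beta)
  ultimately obtain J where J: "J \<subseteq> G" "finite J" "supp \<theta> \<subseteq> (\<Union>z\<in>J. U z)"
    by (metis compactE_image)
  \<comment> \<open>Stated for every test function vanishing off the union, since the induction
    replaces \<phi> by \<phi> (1 - b).\<close>
  have dom: "dominated \<Omega> ?Q (micro_seminorm N V \<phi>)"
    if "\<phi> \<in> test_functions \<Omega>" "\<And>x. x \<notin> (\<Union>z\<in>J. U z) \<Longrightarrow> \<phi> x = 0" for \<phi>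
    using J(2,1) that
  proof (induction J arbitrary: \<phi> rule: finite_induct)
    case empty
    then have "\<phi> = (\<lambda>x. 0)" by auto
    then have "micro_seminorm N V \<phi> w = 0" if "test_linear \<Omega> w" for w
      unfolding micro_seminorm_def using test_linear_zero[OF that]
      by (intro SUP_ennreal_zero) (simp add: fourier_dist_mult)
    then show ?case unfolding dominated_def by (intro exI[of _ "{}"] exI[of _ 0]) auto
  next
    case (insert z J)
    obtain q l j where z: "z = (q, l, j)" by (cases z)
    with insert.prems have q: "q \<in> D" and good: "good_index \<Omega> \<Gamma> V q l j" by (auto simp: G_def)
    let ?b = "bump q (radius l)"
    have \<phi>: "smooth \<phi>" "\<phi> \<in> test_functions \<Omega>" using insert.prems by (auto simp: test_functions_def)
    have d1: "dominated \<Omega> ?Q (micro_seminorm N V (\<lambda>x. \<phi> x * ?b x))"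
      using bump_eq_0[of "radius l" q] radius_pos[of l]
      by (intro good_index_dominated[OF q good] smooth_mult \<phi> smooth_bump) auto
    have d2: "dominated \<Omega> ?Q (micro_seminorm N V (\<lambda>x. \<phi> x * (1 - ?b x)))"
    proof (rule insert.IH)
      show "(\<lambda>x. \<phi> x * (1 - ?b x)) \<in> test_functions \<Omega>"
        by (intro test_functions_mult \<phi> smooth_diff smooth_const smooth_bump)
      show "\<phi> x * (1 - ?b x) = 0" if "x \<notin> (\<Union>z\<in>J. U z)" for x
      proof (cases "x \<in> ball q (radius l)")
        case True
        then show ?thesis using bump_eq_1[of q x "radius l"] radius_pos[of l] by simp
      next
        case False
        then have "\<phi> x = 0" using that by (intro insert.prems) (auto simp: U_def z)
        then show ?thesis by simp
      qed
    qed (use insert.prems in auto)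
    have "micro_seminorm N V \<phi> w \<le> micro_seminorm N V (\<lambda>x. \<phi> x * ?b x) w
        + ennreal 1 * micro_seminorm N V (\<lambda>x. \<phi> x * (1 - ?b x)) w" if "test_linear \<Omega> w" for w
      using micro_seminorm_add[OF that test_functions_mult[OF \<phi>(2) smooth_bump]
          test_functions_mult[OF \<phi>(2) smooth_diff[OF smooth_const smooth_bump]], of N V q "radius l" 1 q "radius l"]
      by (simp add: algebra_simps)
    then show ?case by (intro dominated_combination[OF d1 d2, of 1]) auto
  qed
  show ?thesis
  proof (rule dom)
    show "\<theta> \<in> test_functions \<Omega>" using adm by (simp add: admissible_pair_def)
    show "\<theta> x = 0" if "x \<notin> (\<Union>z\<in>J. U z)" for x using that J(3) by (intro not_in_supp) blast
  qed
qed

theorem mainTheorem18: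
  fixes \<Omega> :: "(real^'n) set" and \<Gamma> :: "((real^'n) \<times> (real^'n)) set"
  assumes "open \<Omega>"
    and "closed_cotangent_cone \<Omega> \<Gamma>"
  shows "\<exists>F :: ((real^'n \<Rightarrow> complex) \<times> (real^'n) set) set.
    countable F \<and>
    (\<forall>(\<theta>, V)\<in>F. admissible_pair \<Omega> \<Gamma> \<theta> V) \<and>
    normal_topology \<Omega> \<Gamma> = seminorm_topology (distributions_WF \<Omega> \<Gamma>)
      (strong_seminorms \<Omega> \<union>
       {micro_seminorm (real N) V \<theta> | (N::nat) V \<theta>. (\<theta>, V) \<in> F})"
proof -
  obtain D :: "(real^'n) set" where D: "countable D" "\<And>X. open X \<Longrightarrow> X \<noteq> {} \<Longrightarrow> \<exists>q\<in>D. q \<in> X"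
    using countable_dense_setE by blast
  let ?F = "countable_family \<Omega> \<Gamma> D"
  have adm: "admissible_pair \<Omega> \<Gamma> \<theta> V" if "(\<theta>, V) \<in> ?F" for \<theta> V
    using countable_family_admissible[OF assms(2) that] .
  have "normal_topology \<Omega> \<Gamma> = seminorm_topology (distributions_WF \<Omega> \<Gamma>) (countable_seminorms \<Omega> ?F)"
    unfolding normal_topology_def
  proof (rule seminorm_topology_eqI)
    show "distributions_WF \<Omega> \<Gamma> \<subseteq> distributions \<Omega>" by (auto simp: distributions_WF_def)
    show "countable_seminorms \<Omega> ?F \<subseteq> strong_seminorms \<Omega> \<union>
        {micro_seminorm N V \<theta> | N V \<theta>. 0 \<le> N \<and> admissible_pair \<Omega> \<Gamma> \<theta> V}"
      unfolding countable_seminorms_def using adm of_nat_0_le_iff by blast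
    fix p assume p: "p \<in> strong_seminorms \<Omega> \<union>
        {micro_seminorm N V \<theta> | N V \<theta>. 0 \<le> N \<and> admissible_pair \<Omega> \<Gamma> \<theta> V} - countable_seminorms \<Omega> ?F"
    \<comment> \<open>Both families contain all strong seminorms, so p is a microlocal one.\<close>
    then obtain N V \<theta> where p': "p = micro_seminorm N V \<theta>" "admissible_pair \<Omega> \<Gamma> \<theta> V"
      by (auto simp: countable_seminorms_def)
    show "dominated \<Omega> (countable_seminorms \<Omega> ?F) p"
      unfolding p'(1) by (rule micro_seminorm_dominated[OF assms p'(2) D(2)])
    show "p (v - u) \<le> p (v - z) + p (z - u)" for u v z
      unfolding p'(1) by (rule micro_seminorm_triangle)
  next
    show "q (u - u) = 0" if "q \<in> countable_seminorms \<Omega> ?F" for q u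
      using that unfolding countable_seminorms_def strong_seminorms_def
      by (auto simp: micro_seminorm_def fourier_dist_mult intro!: SUP_ennreal_zero)
  qed
  then show ?thesis
    using countable_countable_family[OF D(1)] adm unfolding countable_seminorms_def
    by (intro exI[of _ ?F]) auto
qed

end
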